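(* There is a universal constant $c>0$ such that for all integers $n\ge 2$, $k\ge 1$ and every function $f\colon\{0,1\}^n\to\{0,1\}$, $$\mathsf{R}(f^k)\;\ge\; c\cdot\frac{k}{\log n}\cdot \mathsf{D}^\times(f).$$
   Context: Inner products are over $\mathbb{F}_2$: $\langle a,x\rangle=\sum_i a_ix_i \bmod 2$. A deterministic parity decision tree $T$ on $\{0,1\}^N$ is a rooted binary tree in which every internal node is labelled by a vector $a\in\{0,1\}^N$ (the query $\langle a,x\rangle$) and has two children, one for each outcome in $\{0,1\}$, and every leaf is labelled by an output value; $T(x)$ is the label of the leaf reached on input $x$. The depth of $T$ is the maximum number of queries on a root-to-leaf path. A randomised parity decision tree $\mathcal{T}$ is a probability distribution over deterministic ones. For $g\colon\{0,1\}^N\to\{0,1\}^m$, $\mathsf{R}(g)$ is the least $d$ such that some randomised parity decision tree $\mathcal{T}$, supported on trees of depth at most $d$, satisfies $\Pr_{T\sim\mathcal{T}}[T(x)\ne g(x)]\le 1/3$ for every $x$. $f^k\colon(\{0,1\}^n)^k\to\{0,1\}^k$ is $f^k(x^1,\dots,x^k)=(f(x^1),\dots,f(x^k))$. For a probability distribution $\mu$ on $\{0,1\}^n$, $\mathsf{D}_\epsilon(f,\mu)$ is the least depth of a deterministic parity decision tree $T$ with $\Pr_{x\sim\mu}[T(x)\ne f(x)]\le\epsilon$. A distribution on $\{0,1\}^n$ is product if it is a product of $n$ independent Bernoulli distributions. $\mathsf{D}^\times(f)=\max_{\mu\text{ product}}\mathsf{D}_{1/3}(f,\mu)$. *)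

theory Defs
  imports "HOL-Probability.Probability" "HOL-Probability.Product_PMF"
begin

text \<open>
  As the statement quantifies over the dimension, a vector in \<open>{0,1}\<^sup>n\<close> is a function
  \<open>nat \<Rightarrow> bool\<close> that is \<open>False\<close> at all indices \<open>\<ge> n\<close> (coordinates are numbered from 0).
  This is also the representation on which \<^const>\<open>Pi_pmf\<close> with default \<open>False\<close> lives.
  A function on \<open>{0,1}\<^sup>n\<close> is given by a function on the whole type; only its values on
  \<open>cube n\<close> matter below.
\<close>

definition cube :: "nat \<Rightarrow> (nat \<Rightarrow> bool) set" where
  "cube n = {x. \<forall>i\<ge>n. \<not> x i}"

definition ip2 :: "nat \<Rightarrow> (nat \<Rightarrow> bool) \<Rightarrow> (nat \<Rightarrow> bool) \<Rightarrow> bool" where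
  "ip2 N a x \<longleftrightarrow> odd (\<Sum>i<N. of_bool (a i) * of_bool (x i) :: nat)"

text \<open>In \<open>Query a T0 T1\<close> the subtree \<open>T0\<close> belongs to the outcome 0 and \<open>T1\<close> to the outcome 1.\<close>

datatype 'o pdt = Leaf 'o | Query "nat \<Rightarrow> bool" "'o pdt" "'o pdt"

text \<open>\<open>is_pdt N Y T\<close>: \<open>T\<close> is a tree on \<open>{0,1}\<^sup>N\<close> with output values in \<open>Y\<close>.\<close>

primrec is_pdt :: "nat \<Rightarrow> 'o set \<Rightarrow> 'o pdt \<Rightarrow> bool" where
  "is_pdt N Y (Leaf y) \<longleftrightarrow> y \<in> Y"
| "is_pdt N Y (Query a T0 T1) \<longleftrightarrow> a \<in> cube N \<and> is_pdt N Y T0 \<and> is_pdt N Y T1"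

primrec depth :: "'o pdt \<Rightarrow> nat" where
  "depth (Leaf y) = 0"
| "depth (Query a T0 T1) = Suc (max (depth T0) (depth T1))"

primrec run :: "nat \<Rightarrow> 'o pdt \<Rightarrow> (nat \<Rightarrow> bool) \<Rightarrow> 'o" where
  "run N (Leaf y) x = y"
| "run N (Query a T0 T1) x = (if ip2 N a x then run N T1 x else run N T0 x)"

text \<open>
  Randomised complexity of \<open>g : {0,1}\<^sup>N \<rightarrow> {0,1}\<^sup>m\<close>. There are only finitely many such trees
  of depth at most \<open>d\<close>, so discrete distributions are fully general.
\<close>

definition R_pdt :: "nat \<Rightarrow> nat \<Rightarrow> ((nat \<Rightarrow> bool) \<Rightarrow> (nat \<Rightarrow> bool)) \<Rightarrow> nat" where
  "R_pdt N m g = (LEAST d. \<exists>\<T> :: (nat \<Rightarrow> bool) pdt pmf.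
     (\<forall>T\<in>set_pmf \<T>. is_pdt N (cube m) T \<and> depth T \<le> d) \<and>
     (\<forall>x\<in>cube N. measure_pmf.prob \<T> {T. run N T x \<noteq> g x} \<le> 1/3))"

definition D_pdt :: "real \<Rightarrow> nat \<Rightarrow> ((nat \<Rightarrow> bool) \<Rightarrow> bool) \<Rightarrow> (nat \<Rightarrow> bool) pmf \<Rightarrow> nat" where
  "D_pdt \<epsilon> n f \<mu> = (LEAST d. \<exists>T. is_pdt n UNIV T \<and> depth T = d \<and>
     measure_pmf.prob \<mu> {x. run n T x \<noteq> f x} \<le> \<epsilon>)"

definition product_dist :: "nat \<Rightarrow> (nat \<Rightarrow> bool) pmf \<Rightarrow> bool" where
  "product_dist n \<mu> \<longleftrightarrow> (\<exists>p :: nat \<Rightarrow> real. (\<forall>i<n. 0 \<le> p i \<and> p i \<le> 1) \<and>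
     \<mu> = Pi_pmf {..<n} False (\<lambda>i. bernoulli_pmf (p i)))"

definition D_prod :: "nat \<Rightarrow> ((nat \<Rightarrow> bool) \<Rightarrow> bool) \<Rightarrow> nat" where
  "D_prod n f = Max {D_pdt (1/3) n f \<mu> | \<mu>. product_dist n \<mu>}"

text \<open>
  An element of \<open>({0,1}\<^sup>n)\<^sup>k\<close> is its concatenation in \<open>{0,1}\<^bsup>k * n\<^esup>\<close>;
  \<open>block n j x\<close> is its \<open>j\<close>-th component.
\<close>

definition block :: "nat \<Rightarrow> nat \<Rightarrow> (nat \<Rightarrow> bool) \<Rightarrow> (nat \<Rightarrow> bool)" where
  "block n j x = (\<lambda>i. i < n \<and> x (j * n + i))"

definition direct_power ::
    "nat \<Rightarrow> nat \<Rightarrow> ((nat \<Rightarrow> bool) \<Rightarrow> bool) \<Rightarrow> (nat \<Rightarrow> bool) \<Rightarrow> (nat \<Rightarrow> bool)" where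
  "direct_power n k f x = (\<lambda>j. j < k \<and> f (block n j x))"

text \<open>
  The minima and the maximum above are attained: some tree of depth at most \<open>N\<close> computes
  any given function exactly.
\<close>

lemma ip2_unit: "i < N \<Longrightarrow> ip2 N (\<lambda>j. j = i) x \<longleftrightarrow> x i"
proof -
  assume i: "i < N"
  have "(\<Sum>j<N. of_bool (j = i) * of_bool (x j) :: nat) = (\<Sum>j<N. if j = i then of_bool (x j) else 0)"
    by (intro sum.cong) auto
  also have "\<dots> = of_bool (x i)"
    using i by (subst sum.delta) auto
  finally show ?thesis
    by (simp add: ip2_def)
qed

lemma exact_pdt_aux:
  assumes g: "\<And>x. x \<in> cube N \<Longrightarrow> g x \<in> Y"
  shows "d \<le> N \<Longrightarrow> \<exists>T. is_pdt N Y T \<and> depth T \<le> d \<and>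
    (\<forall>x\<in>cube N. (\<forall>i<N - d. x i = y i) \<longrightarrow> run N T x = g x)"
proof (induction d arbitrary: y)
  case 0
  define z where "z = (\<lambda>i. i < N \<and> y i)"
  have z: "z \<in> cube N"
    by (auto simp: z_def cube_def)
  have "x = z" if "x \<in> cube N" "\<forall>i<N. x i = y i" for x
    using that unfolding z_def cube_def fun_eq_iff mem_Collect_eq by (metis not_less)
  then show ?case
    using g[OF z] by (intro exI[of _ "Leaf (g z)"]) auto
next
  case (Suc d)
  define i where "i = N - Suc d"
  have i: "i < N" "N - d = Suc i"
    using Suc.prems by (auto simp: i_def)
  obtain T0 where T0: "is_pdt N Y T0" "depth T0 \<le> d"
    "\<forall>x\<in>cube N. (\<forall>j<Suc i. x j = (y(i := False)) j) \<longrightarrow> run N T0 x = g x"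
    using Suc.IH[of "y(i := False)"] Suc.prems i by auto
  obtain T1 where T1: "is_pdt N Y T1" "depth T1 \<le> d"
    "\<forall>x\<in>cube N. (\<forall>j<Suc i. x j = (y(i := True)) j) \<longrightarrow> run N T1 x = g x"
    using Suc.IH[of "y(i := True)"] Suc.prems i by auto
  have "run N (Query (\<lambda>j. j = i) T0 T1) x = g x" if "x \<in> cube N" "\<forall>j<i. x j = y j" for x
    using that T0(3) T1(3) i by (auto simp: ip2_unit less_Suc_eq)
  moreover have "(\<lambda>j. j = i) \<in> cube N"
    using i by (auto simp: cube_def)
  ultimately show ?case
    using T0 T1 by (intro exI[of _ "Query (\<lambda>j. j = i) T0 T1"]) (auto simp: i_def)
qed

lemma exact_pdt:
  assumes "\<And>x. x \<in> cube N \<Longrightarrow> g x \<in> Y"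
  shows "\<exists>T. is_pdt N Y T \<and> depth T \<le> N \<and> (\<forall>x\<in>cube N. run N T x = g x)"
  using exact_pdt_aux[of N g Y N] assms by auto

lemma product_dist_cube:
  assumes "product_dist n \<mu>"
  shows "set_pmf \<mu> \<subseteq> cube n"
proof -
  obtain p :: "nat \<Rightarrow> real" where "\<mu> = Pi_pmf {..<n} False (\<lambda>i. bernoulli_pmf (p i))"
    using assms by (auto simp: product_dist_def)
  then show ?thesis
    using set_Pi_pmf_subset[of "{..<n}" False "\<lambda>i. bernoulli_pmf (p i)"]
    by (auto simp: cube_def)
qed

lemma R_pdt_attained:
  assumes "\<And>x. x \<in> cube N \<Longrightarrow> g x \<in> cube m"
  shows "\<exists>\<T>. (\<forall>T\<in>set_pmf \<T>. is_pdt N (cube m) T \<and> depth T \<le> R_pdt N m g) \<and>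
     (\<forall>x\<in>cube N. measure_pmf.prob \<T> {T. run N T x \<noteq> g x} \<le> 1/3)"
proof -
  obtain T where T: "is_pdt N (cube m) T" "depth T \<le> N" "\<forall>x\<in>cube N. run N T x = g x"
    using exact_pdt[of N g "cube m"] assms by auto
  show ?thesis
    unfolding R_pdt_def
    by (rule LeastI[of _ N], rule exI[of _ "return_pmf T"]) (use T in auto)
qed

lemma D_pdt_attained:
  assumes "product_dist n \<mu>" "\<epsilon> \<ge> 0"
  shows "\<exists>T. is_pdt n UNIV T \<and> depth T = D_pdt \<epsilon> n f \<mu> \<and>
           measure_pmf.prob \<mu> {x. run n T x \<noteq> f x} \<le> \<epsilon>"
    and "D_pdt \<epsilon> n f \<mu> \<le> n"
proof -
  obtain T where T: "is_pdt n UNIV T" "depth T \<le> n" "\<forall>x\<in>cube n. run n T x = f x"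
    using exact_pdt[of n f UNIV] by auto
  have "measure_pmf.prob \<mu> {x. run n T x \<noteq> f x} = 0"
    using T(3) product_dist_cube[OF assms(1)]
    by (subst measure_pmf_zero_iff) auto
  then have *: "\<exists>T'. is_pdt n UNIV T' \<and> depth T' = depth T \<and>
      measure_pmf.prob \<mu> {x. run n T' x \<noteq> f x} \<le> \<epsilon>"
    using T assms(2) by auto
  show "\<exists>T. is_pdt n UNIV T \<and> depth T = D_pdt \<epsilon> n f \<mu> \<and>
      measure_pmf.prob \<mu> {x. run n T x \<noteq> f x} \<le> \<epsilon>"
    unfolding D_pdt_def by (rule LeastI[of _ "depth T"]) (rule *)
  have "D_pdt \<epsilon> n f \<mu> \<le> depth T"
    unfolding D_pdt_def by (rule Least_le) (rule *)
  then show "D_pdt \<epsilon> n f \<mu> \<le> n"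
    using T(2) by simp
qed

lemma D_prod_attained: "\<exists>\<mu>. product_dist n \<mu> \<and> D_prod n f = D_pdt (1/3) n f \<mu>"
proof -
  let ?A = "{D_pdt (1/3) n f \<mu> | \<mu>. product_dist n \<mu>}"
  have "?A \<subseteq> {..n}"
    using D_pdt_attained(2)[where \<epsilon> = "1/3"] by auto
  then have "finite ?A"
    by (rule finite_subset) simp
  moreover have "product_dist n (Pi_pmf {..<n} False (\<lambda>i. bernoulli_pmf 0))"
    by (auto simp: product_dist_def intro!: exI[of _ "\<lambda>_. 0"])
  then have "?A \<noteq> {}"
    by blast
  ultimately have "Max ?A \<in> ?A"
    by (rule Max_in)
  then show ?thesis
    by (auto simp: D_prod_def)
qed

end

theory Submission
  imports Defs
begin

text \<open>
  After flipping bits, every bias is at most 1/2, so a biased bit is 0 with probability \<open>1 - 2p\<close>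
  and otherwise a fair coin. Let \<open>T\<close> be a tree for \<open>f\<^sup>k\<close> on such an input. A query that involves
  a fair bit of the last block is a fair coin itself, whatever the other blocks are, and
  it can be used to express that bit by the others. Replacing such queries by coins yields a tree
  on the first \<open>k - 1\<close> blocks that saves as many queries as there were coins. So the expected
  numbers of coins of all blocks add up to at most the depth of \<open>T\<close>, and it remains to simulate \<open>T\<close>
  on a single block, all others being fixed, at a cost of \<open>O(log n)\<close> per coin.

  The simulation does not know which bits are fair. It follows the path of \<open>T\<close> on which no fair bit
  is met and collects the queried bits until one of them is fair with constant probability.
  Random parities and binary search find the first collected bit with value 1 at cost \<open>O(log n)\<close>,
  and bits with value 0 are declared fair by an internal coin. With constant probability this
  batch finds a fair bit and is paid for by the coin that it produces. The last, incomplete batch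
  is ignored, which costs a small error. All random choices are fixed by averaging.

  Since the errors of the simulation have to be absorbed, the error of the randomised tree is first reduced
  from 1/3 to 7/27 by a majority vote of three runs.
\<close>

section \<open>Averages over biased bits\<close>

text \<open>Coordinates outside \<open>U\<close> are read from \<open>z\<close>. An average over
  \<open>U\<close> is thus again a function of vectors, so averages over disjoint sets can be
  nested.\<close>

definition avg :: "(nat \<Rightarrow> real) \<Rightarrow> nat set \<Rightarrow> ((nat \<Rightarrow> bool) \<Rightarrow> real) \<Rightarrow> (nat \<Rightarrow> bool) \<Rightarrow> real" where
  "avg p U \<phi> z = measure_pmf.expectation (Pi_pmf U False (\<lambda>i. bernoulli_pmf (p i)))
     (\<lambda>x. \<phi> (\<lambda>i. if i \<in> U then x i else z i))"

lemma avg_empty [simp]: "avg p {} \<phi> z = \<phi> z"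
  by (simp add: avg_def)

lemma finite_set_Pi_bernoulli:
  assumes "finite U"
  shows "finite (set_pmf (Pi_pmf U False (\<lambda>i. bernoulli_pmf (p i))))"
proof (rule finite_subset)
  show "set_pmf (Pi_pmf U False (\<lambda>i. bernoulli_pmf (p i))) \<subseteq> PiE_dflt U False (\<lambda>_. UNIV)"
    using assms by (auto simp: set_Pi_pmf PiE_dflt_def)
  show "finite (PiE_dflt U False (\<lambda>_. UNIV :: bool set))"
    using assms by (intro finite_PiE_dflt) auto
qed

lemma avg_cong:
  assumes "\<And>x. (\<And>i. i \<notin> U \<Longrightarrow> x i = z i) \<Longrightarrow> \<phi> x = \<psi> x"
  shows "avg p U \<phi> z = avg p U \<psi> z"
proof -
  have "(\<lambda>x. \<phi> (\<lambda>i. if i \<in> U then x i else z i)) = (\<lambda>x. \<psi> (\<lambda>i. if i \<in> U then x i else z i))"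
    by (intro ext assms) auto
  then show ?thesis
    by (simp add: avg_def)
qed

lemma avg_base_cong:
  assumes "\<And>i. i \<notin> U \<Longrightarrow> z i = z' i"
  shows "avg p U \<phi> z = avg p U \<phi> z'"
proof -
  have "(\<lambda>x i. if i \<in> U then x i else z i) = (\<lambda>x i. if i \<in> U then x i else z' i)"
    using assms by auto
  then show ?thesis
    unfolding avg_def by metis
qed

lemma avg_const [simp]: "avg p U (\<lambda>_. c) z = c"
  by (simp add: avg_def)

lemma avg_mono:
  assumes "finite U" "\<And>x. (\<And>i. i \<notin> U \<Longrightarrow> x i = z i) \<Longrightarrow> \<phi> x \<le> \<psi> x"
  shows "avg p U \<phi> z \<le> avg p U \<psi> z"
  unfolding avg_def
  by (intro integral_mono integrable_measure_pmf_finite finite_set_Pi_bernoulli assms) auto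

lemma avg_add:
  assumes "finite U"
  shows "avg p U (\<lambda>x. \<phi> x + \<psi> x) z = avg p U \<phi> z + avg p U \<psi> z"
  unfolding avg_def
  by (intro Bochner_Integration.integral_add integrable_measure_pmf_finite finite_set_Pi_bernoulli assms)

lemma avg_diff:
  assumes "finite U"
  shows "avg p U (\<lambda>x. \<phi> x - \<psi> x) z = avg p U \<phi> z - avg p U \<psi> z"
  unfolding avg_def
  by (intro Bochner_Integration.integral_diff integrable_measure_pmf_finite finite_set_Pi_bernoulli assms)

lemma avg_mult [simp]: "avg p U (\<lambda>x. c * \<phi> x) z = c * avg p U \<phi> z"
  by (simp add: avg_def)

lemma avg_sum:
  assumes "finite U"
  shows "avg p U (\<lambda>x. \<Sum>j\<in>J. \<phi> j x) z = (\<Sum>j\<in>J. avg p U (\<phi> j) z)"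
  unfolding avg_def
  by (intro Bochner_Integration.integral_sum integrable_measure_pmf_finite finite_set_Pi_bernoulli assms)

lemma avg_ge:
  assumes "finite U" "\<And>x. c \<le> \<phi> x"
  shows "c \<le> avg p U \<phi> z"
  using avg_mono[of U z "\<lambda>_. c" \<phi> p] assms by simp

lemma avg_insert:
  assumes "finite U" "i \<notin> U" "0 \<le> p i" "p i \<le> 1"
  shows "avg p (insert i U) \<phi> z =
    p i * avg p U \<phi> (z(i := True)) + (1 - p i) * avg p U \<phi> (z(i := False))"
proof -
  let ?\<mu> = "Pi_pmf U False (\<lambda>i. bernoulli_pmf (p i))"
  have *: "measure_pmf.expectation (map_pmf (\<lambda>f. f(i := b)) ?\<mu>)
      (\<lambda>x. \<phi> (\<lambda>j. if j \<in> insert i U then x j else z j)) = avg p U \<phi> (z(i := b))" for b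
  proof -
    have "(\<lambda>j. if j \<in> insert i U then (x(i := b)) j else z j) =
        (\<lambda>j. if j \<in> U then x j else (z(i := b)) j)" for x
      using assms(2) by auto
    then show ?thesis
      unfolding avg_def integral_map_pmf by (simp only:)
  qed
  have "Pi_pmf (insert i U) False (\<lambda>i. bernoulli_pmf (p i)) =
      bernoulli_pmf (p i) \<bind> (\<lambda>b. map_pmf (\<lambda>f. f(i := b)) ?\<mu>)"
    by (simp add: Pi_pmf_insert'[OF assms(1,2)] map_pmf_def)
  then have "avg p (insert i U) \<phi> z =
     measure_pmf.expectation (bernoulli_pmf (p i) \<bind> (\<lambda>b. map_pmf (\<lambda>f. f(i := b)) ?\<mu>))
      (\<lambda>x. \<phi> (\<lambda>j. if j \<in> insert i U then x j else z j))"
    by (simp add: avg_def)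
  also have "\<dots> = (\<Sum>b\<in>UNIV. pmf (bernoulli_pmf (p i)) b * avg p U \<phi> (z(i := b)))"
    by (subst pmf_expectation_bind[of UNIV])
      (use assms(1) in \<open>auto simp only: * finite_set_Pi_bernoulli set_map_pmf real_scaleR_def
        intro!: finite_imageI finite_class.finite_UNIV\<close>)
  finally show ?thesis
    using assms by (simp add: UNIV_bool)
qed

definition biases :: "(nat \<Rightarrow> real) \<Rightarrow> bool" where
  "biases p \<longleftrightarrow> (\<forall>i. 0 \<le> p i \<and> p i \<le> 1)"

lemma avg_upd:
  assumes "i \<notin> U"
  shows "avg p U \<phi> (z(i := c)) = avg p U (\<lambda>x. \<phi> (x(i := c))) (z(i := b))"
proof -
  have "(\<lambda>j. if j \<in> U then x j else (z(i := c)) j) =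
      (\<lambda>j. if j \<in> U then x j else (z(i := b)) j)(i := c)" for x
    using assms by (intro ext) auto
  then show ?thesis
    unfolding avg_def by (simp only:)
qed

lemma avg_union:
  assumes "finite U" "finite W" "U \<inter> W = {}" "biases p"
  shows "avg p (U \<union> W) \<phi> z = avg p W (avg p U \<phi>) z"
  using assms(2,3)
proof (induction W arbitrary: z rule: finite_induct)
  case (insert i W)
  then have "avg p (insert i (U \<union> W)) \<phi> z =
      p i * avg p (U \<union> W) \<phi> (z(i := True)) + (1 - p i) * avg p (U \<union> W) \<phi> (z(i := False))"
    using assms by (intro avg_insert) (auto simp: biases_def)
  with insert show ?case
    using assms by (simp add: avg_insert biases_def)
qed simp

text \<open>Exchanging the two values of the bits marked by \<open>m\<close> turns a bias p into 1 -
  p. This reduces arbitrary product distributions to biases of at most 1/2.\<close>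

lemma avg_flip:
  assumes "finite U" "biases p"
  shows "avg (\<lambda>i. if m i then 1 - p i else p i) U \<phi> (\<lambda>i. z i \<noteq> m i) = avg p U (\<lambda>x. \<phi> (\<lambda>i. x i \<noteq> m i)) z"
  using assms(1)
proof (induction U arbitrary: z rule: finite_induct)
  case (insert i U)
  let ?q = "\<lambda>i. if m i then 1 - p i else p i"
  have *: "(\<lambda>j. z j \<noteq> m j)(i := b) = (\<lambda>j. (z(i := (b \<noteq> m i))) j \<noteq> m j)" for b
    by (rule ext) auto
  have "avg ?q U \<phi> ((\<lambda>j. z j \<noteq> m j)(i := b)) =
      avg p U (\<lambda>x. \<phi> (\<lambda>i. x i \<noteq> m i)) (z(i := (b \<noteq> m i)))" for b
    unfolding * by (rule insert.IH)
  note this[of True] this[of False]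
  moreover have "biases ?q"
    using assms(2) by (auto simp: biases_def)
  then have "avg ?q (insert i U) \<phi> (\<lambda>j. z j \<noteq> m j) =
      ?q i * avg ?q U \<phi> ((\<lambda>j. z j \<noteq> m j)(i := True)) +
      (1 - ?q i) * avg ?q U \<phi> ((\<lambda>j. z j \<noteq> m j)(i := False))"
    using insert.hyps by (intro avg_insert) (auto simp: biases_def)
  moreover have "avg p (insert i U) (\<lambda>x. \<phi> (\<lambda>i. x i \<noteq> m i)) z =
      p i * avg p U (\<lambda>x. \<phi> (\<lambda>i. x i \<noteq> m i)) (z(i := True)) +
      (1 - p i) * avg p U (\<lambda>x. \<phi> (\<lambda>i. x i \<noteq> m i)) (z(i := False))"
    using insert.hyps assms(2) by (intro avg_insert) (auto simp: biases_def)
  ultimately show ?case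
    by (cases "m i") simp_all
qed simp

text \<open>Fubini, with the average over \<open>U\<close> unfolded bit by bit. The uniform bound
  gives integrability over \<open>\<T>\<close>, whose support may be infinite.\<close>

lemma avg_swap_expectation:
  fixes \<psi> :: "(nat \<Rightarrow> bool) \<Rightarrow> 'a \<Rightarrow> real"
  assumes "finite U" "biases p" "\<And>x t. \<bar>\<psi> x t\<bar> \<le> c"
  shows "measure_pmf.expectation \<T> (\<lambda>t. avg p U (\<lambda>x. \<psi> x t) z) =
    avg p U (\<lambda>x. measure_pmf.expectation \<T> (\<psi> x)) z"
  using assms(1)
proof (induction U arbitrary: z rule: finite_induct)
  case (insert i U)
  have "\<bar>avg p U (\<lambda>x. \<psi> x t) z\<bar> \<le> c" for z t
    using avg_mono[OF insert(1), of z "\<lambda>_. -c" "\<lambda>x. \<psi> x t" p]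
      avg_mono[OF insert(1), of z "\<lambda>x. \<psi> x t" "\<lambda>_. c" p] assms(3)[of _ t]
    by (auto simp: abs_le_iff minus_le_iff)
  then have "integrable (measure_pmf \<T>) (\<lambda>t. avg p U (\<lambda>x. \<psi> x t) z)" for z
    by (intro measure_pmf.integrable_const_bound[of _ c]) auto
  then show ?case
    using assms(2) insert.hyps by (simp add: avg_insert biases_def insert.IH del: fun_upd_apply)
qed simp

section \<open>Trees with affine queries\<close>

text \<open>These are the affine functions over F_2 in the bits of \<open>U\<close>. Generating them
  by rules makes closure under substitution a rule induction.\<close>

inductive aff :: "nat set \<Rightarrow> ((nat \<Rightarrow> bool) \<Rightarrow> bool) \<Rightarrow> bool" for U where
  aff_const: "aff U (\<lambda>x. c)"
| aff_coord: "i \<in> U \<Longrightarrow> aff U (\<lambda>x. x i)"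
| aff_xor: "aff U g \<Longrightarrow> aff U h \<Longrightarrow> aff U (\<lambda>x. g x \<noteq> h x)"

lemma aff_subst:
  assumes "aff U h" "\<And>i. i \<in> U \<Longrightarrow> aff W (\<lambda>x. \<sigma> x i)"
  shows "aff W (\<lambda>x. h (\<sigma> x))"
  using assms(1)
proof induction
  case (aff_xor g h)
  show ?case
    by (rule aff.aff_xor) (rule aff_xor.IH)+
qed (auto intro: aff.intros assms(2))

lemma aff_mono: "aff U h \<Longrightarrow> U \<subseteq> W \<Longrightarrow> aff W h"
  using aff_subst[of U h W "\<lambda>x. x"] by (auto intro: aff.intros)

lemma aff_upd:
  assumes "aff U h" "aff (U - {i}) g"
  shows "aff (U - {i}) (\<lambda>x. h (x(i := g x)))"
proof (rule aff_subst[OF assms(1)])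
  fix j assume "j \<in> U"
  then show "aff (U - {i}) (\<lambda>x. (x(i := g x)) j)"
    using assms(2) by (cases "j = i") (auto intro: aff.intros)
qed

lemma aff_not: "aff U h \<Longrightarrow> aff U (\<lambda>x. b \<noteq> h x)"
  by (rule aff_xor[OF aff_const])

lemma aff_cong_on:
  assumes "aff U h" "\<And>i. i \<in> U \<Longrightarrow> x i = y i"
  shows "h x = h y"
  using assms(1) by induction (auto simp: assms(2))

section \<open>Dependence of an affine function on a single bit\<close>

text \<open>For an affine \<open>h\<close> this means that bit \<open>i\<close> has coefficient 1;
  \<open>h (x(i := False))\<close> is the remainder of the form.\<close>

definition flips :: "((nat \<Rightarrow> bool) \<Rightarrow> bool) \<Rightarrow> nat \<Rightarrow> bool" where
  "flips h i \<longleftrightarrow> (\<forall>x. h x = (x i \<noteq> h (x(i := False))))"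

lemma flips_upd:
  assumes "flips h i"
  shows "h (x(i := b)) \<longleftrightarrow> b \<noteq> h (x(i := False))"
  using assms[unfolded flips_def, rule_format, of "x(i := b)"] by simp

lemma flipsI:
  assumes "\<And>x b. h (x(i := b)) \<longleftrightarrow> b \<noteq> h (x(i := False))"
  shows "flips h i"
  unfolding flips_def
proof
  show "h x \<longleftrightarrow> x i \<noteq> h (x(i := False))" for x
    using assms[of x "x i"] by simp
qed

text \<open>The coefficient of bit \<open>i\<close> is 1 or 0. In a sum, two coefficients 1
  cancel.\<close>

lemma aff_flips_cases:
  assumes "aff U h"
  shows "flips h i \<or> (\<forall>x b. h (x(i := b)) = h x)"
  using assms
proof induction
  case (aff_coord j)
  then show ?case
    by (cases "i = j") (auto simp: flips_def)
next
  case (aff_xor g h)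
  consider "flips g i" "flips h i" | "flips g i" "\<forall>x b. h (x(i := b)) = h x"
    | "\<forall>x b. g (x(i := b)) = g x" "flips h i" | "\<forall>x b. g (x(i := b)) = g x" "\<forall>x b. h (x(i := b)) = h x"
    using aff_xor.IH by blast
  then show ?case
  proof cases
    case 1
    have "(g (x(i := b)) \<noteq> h (x(i := b))) = (g x \<noteq> h x)" for x b
      using flips_upd[OF 1(1), of x b] flips_upd[OF 1(2), of x b]
        flips_upd[OF 1(1), of x "x i"] flips_upd[OF 1(2), of x "x i"] by (simp only: fun_upd_triv) argo
    then show ?thesis by blast
  next
    case 2
    have "flips (\<lambda>x. g x \<noteq> h x) i"
    proof (rule flipsI)
      show "(g (x(i := b)) \<noteq> h (x(i := b))) = (b \<noteq> (g (x(i := False)) \<noteq> h (x(i := False))))" for x b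
        using flips_upd[OF 2(1), of x b] 2(2)[rule_format, of x b] 2(2)[rule_format, of x False] by argo
    qed
    then show ?thesis ..
  next
    case 3
    have "flips (\<lambda>x. g x \<noteq> h x) i"
    proof (rule flipsI)
      show "(g (x(i := b)) \<noteq> h (x(i := b))) = (b \<noteq> (g (x(i := False)) \<noteq> h (x(i := False))))" for x b
        using flips_upd[OF 3(2), of x b] 3(1)[rule_format, of x b] 3(1)[rule_format, of x False] by argo
    qed
    then show ?thesis ..
  next
    case 4
    then have "\<forall>x b. (g (x(i := b)) \<noteq> h (x(i := b))) = (g x \<noteq> h x)"
      by (simp only:) simp
    then show ?thesis ..
  qed
qed auto

text \<open>Bits with coefficient 0 can be set to 0 one after the other without changing
  \<open>h\<close>, and this removes them from the affine expression.\<close>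

lemma aff_no_flips:
  assumes "aff V h" "finite U" "\<And>i. i \<in> U \<Longrightarrow> \<not> flips h i"
  shows "aff (V - U) h"
  using assms(2,3)
proof (induction U rule: finite_induct)
  case empty
  then show ?case using assms(1) by simp
next
  case (insert i U)
  then have "aff (V - U - {i}) (\<lambda>x. h (x(i := False)))"
    by (intro aff_upd[OF _ aff_const]) auto
  moreover have "(\<lambda>x. h (x(i := False))) = h"
    using aff_flips_cases[OF assms(1), of i] insert by auto
  moreover have "V - insert i U = V - U - {i}"
    by auto
  ultimately show ?case
    by simp
qed

text \<open>
  Queries are functions rather than coefficient vectors, so that substituting an affine
  expression for a bit is composition.
\<close>

datatype 'o qtree = QLeaf 'o | QNode "(nat \<Rightarrow> bool) \<Rightarrow> bool" "'o qtree" "'o qtree"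

primrec qrun :: "'o qtree \<Rightarrow> (nat \<Rightarrow> bool) \<Rightarrow> 'o" where
  "qrun (QLeaf y) x = y"
| "qrun (QNode h T0 T1) x = (if h x then qrun T1 x else qrun T0 x)"

text \<open>Queries are counted per input, since eliminating a block saves queries only in
  expectation.\<close>

primrec qcost :: "'o qtree \<Rightarrow> (nat \<Rightarrow> bool) \<Rightarrow> nat" where
  "qcost (QLeaf y) x = 0"
| "qcost (QNode h T0 T1) x = Suc (if h x then qcost T1 x else qcost T0 x)"

primrec over :: "nat set \<Rightarrow> 'o qtree \<Rightarrow> bool" where
  "over U (QLeaf y) \<longleftrightarrow> True"
| "over U (QNode h T0 T1) \<longleftrightarrow> aff U h \<and> over U T0 \<and> over U T1"

primrec qsubst :: "((nat \<Rightarrow> bool) \<Rightarrow> (nat \<Rightarrow> bool)) \<Rightarrow> 'o qtree \<Rightarrow> 'o qtree" where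
  "qsubst \<sigma> (QLeaf y) = QLeaf y"
| "qsubst \<sigma> (QNode h T0 T1) = QNode (\<lambda>x. h (\<sigma> x)) (qsubst \<sigma> T0) (qsubst \<sigma> T1)"

primrec graft :: "'o qtree \<Rightarrow> ('o \<Rightarrow> 'q qtree) \<Rightarrow> 'q qtree" where
  "graft (QLeaf y) C = C y"
| "graft (QNode h T0 T1) C = QNode h (graft T0 C) (graft T1 C)"

lemma qrun_subst [simp]: "qrun (qsubst \<sigma> T) x = qrun T (\<sigma> x)"
  by (induction T) auto

lemma qcost_subst [simp]: "qcost (qsubst \<sigma> T) x = qcost T (\<sigma> x)"
  by (induction T) auto

lemma over_subst:
  assumes "over U T" "\<And>i. i \<in> U \<Longrightarrow> aff W (\<lambda>x. \<sigma> x i)"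
  shows "over W (qsubst \<sigma> T)"
  using assms(1) by (induction T) (auto intro: aff_subst assms(2))

lemma over_mono: "over U T \<Longrightarrow> U \<subseteq> W \<Longrightarrow> over W T"
  by (induction T) (auto intro: aff_mono)

lemma over_upd:
  assumes "over U T" "aff (U - {i}) g"
  shows "over (U - {i}) (qsubst (\<lambda>x. x(i := g x)) T)"
proof (rule over_subst[OF assms(1)])
  fix j assume "j \<in> U"
  then show "aff (U - {i}) (\<lambda>x. (x(i := g x)) j)"
    using assms(2) by (cases "j = i") (auto intro: aff.intros)
qed

lemma qrun_graft [simp]: "qrun (graft T C) x = qrun (C (qrun T x)) x"
  by (induction T) auto

lemma qcost_graft [simp]: "qcost (graft T C) x = qcost T x + qcost (C (qrun T x)) x"
  by (induction T) auto

lemma over_graft: "over U T \<Longrightarrow> (\<And>y. over U (C y)) \<Longrightarrow> over U (graft T C)"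
  by (induction T) auto

text \<open>
  The expected number of queries that have to be answered by a fair coin when the block \<open>U\<close> is
  eliminated from \<open>T\<close>. A bit with bias \<open>p i \<le> 1/2\<close> is 0 with probability \<open>1 - 2 * p i\<close> and
  otherwise a fair coin. If a query involves such a fair bit, then its answer \<open>b\<close> is
  a fair coin as well, and the bit can be expressed by \<open>b\<close> and the other bits.
\<close>

function pivots :: "(nat \<Rightarrow> real) \<Rightarrow> nat set \<Rightarrow> 'o qtree \<Rightarrow> (nat \<Rightarrow> bool) \<Rightarrow> real" where
  "pivots p U (QLeaf y) z = 0"
| "pivots p U (QNode h T0 T1) z =
    (if finite U \<and> (\<exists>i\<in>U. flips h i) then
       let i = (LEAST i. i \<in> U \<and> flips h i) in
         (1 - 2 * p i) * pivots p (U - {i}) (qsubst (\<lambda>x. x(i := False)) (QNode h T0 T1)) (z(i := False)) +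
         p i * (1 + pivots p (U - {i}) (qsubst (\<lambda>x. x(i := h (x(i := False)))) T0) (z(i := False))) +
         p i * (1 + pivots p (U - {i}) (qsubst (\<lambda>x. x(i := (\<not> h (x(i := False))))) T1) (z(i := False)))
     else if h z then pivots p U T1 z else pivots p U T0 z)"
  by pat_completeness auto

lemma pivot_choice:
  assumes "\<exists>i\<in>U. flips h i"
  shows "(LEAST i. i \<in> U \<and> flips h i) \<in> U" "flips h (LEAST i. i \<in> U \<and> flips h i)"
  using LeastI_ex[of "\<lambda>i. i \<in> U \<and> flips h i"] assms by blast+

termination
\<comment> \<open>When a pivot is found, the first tree keeps its root, so only the number of bits
  decreases. Without a pivot the block stays and the tree shrinks.\<close>
proof (relation "measures [\<lambda>(p, U, T, z). card U, \<lambda>(p, U, T, z). size T]", goal_cases)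
  case (2 p U h T0 T1 z i)
  then have "card (U - {i}) < card U"
    using pivot_choice(1)[of U h] by (intro card_Diff1_less) auto
  then show ?case by simp
next
  case (3 p U h T0 T1 z i)
  then have "card (U - {i}) < card U"
    using pivot_choice(1)[of U h] by (intro card_Diff1_less) auto
  then show ?case by simp
next
  case (4 p U h T0 T1 z i)
  then have "card (U - {i}) < card U"
    using pivot_choice(1)[of U h] by (intro card_Diff1_less) auto
  then show ?case by simp
qed auto

declare pivots.simps(2) [simp del]

section \<open>Elimination of a block\<close>

text \<open>For every \<open>x\<close> the values \<open>g x\<close> and \<open>\<not> g x\<close>
  are True and False in some order. So a fair bit stays fair when a function of the other bits is
  added to it.\<close>

lemma avg_fair:
  assumes "finite U" "i \<notin> U"
  shows "avg p U \<phi> (z(i := True)) + avg p U \<phi> (z(i := False)) =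
    avg p U (\<lambda>x. \<phi> (x(i := g x))) (z(i := False)) + avg p U (\<lambda>x. \<phi> (x(i := (\<not> g x)))) (z(i := False))"
proof -
  let ?A = "\<lambda>\<psi>. avg p U \<psi> (z(i := False))"
  have "?A (\<lambda>x. \<phi> (x(i := g x))) + ?A (\<lambda>x. \<phi> (x(i := (\<not> g x)))) =
      ?A (\<lambda>x. \<phi> (x(i := g x)) + \<phi> (x(i := (\<not> g x))))"
    using assms(1) by (simp add: avg_add)
  also have "\<dots> = ?A (\<lambda>x. \<phi> (x(i := True)) + \<phi> (x(i := False)))"
  proof (rule avg_cong)
    show "\<phi> (x(i := g x)) + \<phi> (x(i := (\<not> g x))) = \<phi> (x(i := True)) + \<phi> (x(i := False))" for x
      by (cases "g x") simp_all
  qed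
  also have "\<dots> = ?A (\<lambda>x. \<phi> (x(i := True))) + ?A (\<lambda>x. \<phi> (x(i := False)))"
    using assms(1) by (simp add: avg_add)
  finally show ?thesis
    using avg_upd[OF assms(2)] by simp
qed

text \<open>The bit is 0 with probability 1 - 2 p and fair otherwise. With
  \<open>g x = h (x(i := False))\<close> for a query \<open>h\<close> that flips with
  \<open>i\<close>, the last two terms are the answers 0 and 1 of \<open>h\<close>.\<close>

lemma avg_free:
  assumes "finite U" "i \<in> U" "biases p"
  shows "avg p U \<phi> z =
    (1 - 2 * p i) * avg p (U - {i}) \<phi> (z(i := False)) +
    p i * avg p (U - {i}) (\<lambda>x. \<phi> (x(i := g x))) (z(i := False)) +
    p i * avg p (U - {i}) (\<lambda>x. \<phi> (x(i := (\<not> g x)))) (z(i := False))"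
proof -
  have "avg p U \<phi> z = p i * avg p (U - {i}) \<phi> (z(i := True)) + (1 - p i) * avg p (U - {i}) \<phi> (z(i := False))"
    using avg_insert[of "U - {i}" i p \<phi> z] assms by (simp add: insert_absorb biases_def)
  also have "\<dots> = (1 - 2 * p i) * avg p (U - {i}) \<phi> (z(i := False)) +
      p i * (avg p (U - {i}) \<phi> (z(i := True)) + avg p (U - {i}) \<phi> (z(i := False)))"
    by (simp add: algebra_simps)
  also have "avg p (U - {i}) \<phi> (z(i := True)) + avg p (U - {i}) \<phi> (z(i := False)) =
      avg p (U - {i}) (\<lambda>x. \<phi> (x(i := g x))) (z(i := False)) +
      avg p (U - {i}) (\<lambda>x. \<phi> (x(i := (\<not> g x)))) (z(i := False))"
    using assms by (intro avg_fair) auto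
  finally show ?thesis
    by (simp only: distrib_left add.assoc)
qed

lemma min_le_mix:
  fixes a b c :: real
  assumes "0 \<le> q" "q \<le> 1/2"
  shows "a \<le> (1 - 2 * q) * a + q * b + q * c \<or> b \<le> (1 - 2 * q) * a + q * b + q * c
    \<or> c \<le> (1 - 2 * q) * a + q * b + q * c"
proof -
  define m where "m = min a (min b c)"
  have "(1 - 2 * q) * m \<le> (1 - 2 * q) * a" "q * m \<le> q * b" "q * m \<le> q * c"
    using assms by (auto intro!: mult_left_mono simp: m_def)
  then have "m \<le> (1 - 2 * q) * a + q * b + q * c"
    by (simp add: algebra_simps)
  then show ?thesis
    by (auto simp: m_def min_def split: if_splits)
qed

lemma indep_agree:
  assumes "finite U" "\<And>i x b. i \<in> U \<Longrightarrow> \<phi> (x(i := b)) = \<phi> x" "\<And>i. i \<notin> U \<Longrightarrow> x i = z i"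
  shows "\<phi> x = \<phi> z"
  using assms
proof (induction U arbitrary: x rule: finite_induct)
  case empty
  then have "x = z" by auto
  then show ?case by simp
next
  case (insert i U)
  have "\<phi> (x(i := z i)) = \<phi> z"
    using insert.prems by (intro insert.IH) auto
  then show ?case
    using insert.prems(1)[of i x] by simp
qed

text \<open>A query that involves no bit of \<open>U\<close> is kept, and the weight
  \<open>w\<close> restricts the claim to the inputs that reach a given subtree. A query that flips
  with a bit of \<open>U\<close> is split by \<open>avg_free\<close> into three trees without this
  bit, one of which is at least as good as the mixture. In the two cases of a fair bit the query
  itself is saved, and \<open>pivots\<close> counts these savings.\<close>

lemma eliminate_block:
  fixes T :: "'z0 qtree" and \<gamma> :: real
  assumes fin: "finite U" "finite Z" and disj: "U \<inter> Z = {}"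
    and p: "biases p" "\<And>i. p i \<le> 1/2"
    and T: "over (U \<union> Z) T" and w: "\<And>z. 0 \<le> w z"
    and L: "\<And>x y i b. i \<in> U \<Longrightarrow> L (x(i := b)) y = L x y" and z0: "\<And>i. i \<in> U \<Longrightarrow> \<not> z0 i"
  shows "\<exists>T'. over Z T' \<and>
    avg p Z (\<lambda>z. w z * (L z (qrun T' z) + \<gamma> * qcost T' z)) z0 \<le>
    avg p Z (\<lambda>z. w z * (avg p U (\<lambda>x. L x (qrun T x) + \<gamma> * qcost T x) z - \<gamma> * pivots p U T z)) z0"
  using fin(1) disj T w L z0
proof (induction "card U" arbitrary: U T w rule: less_induct)
  case less
  note IH = less.hyps
  note U = less.prems(1,2)
  note L = less.prems(5)
  note z0 = less.prems(6)
  define \<Phi> where "\<Phi> U T z = avg p U (\<lambda>x. L x (qrun T x) + \<gamma> * qcost T x) z - \<gamma> * pivots p U T z"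
    for U and T :: "'z0 qtree" and z
  have L_avg: "avg p U (\<lambda>x. L x y) z = L z y" for y z
  proof -
    have "avg p U (\<lambda>x. L x y) z = avg p U (\<lambda>_. L z y) z"
      by (rule avg_cong, rule indep_agree[where \<phi> = "\<lambda>x. L x y", OF U(1)]) (auto simp: L)
    then show ?thesis by simp
  qed
  show ?case
    using less.prems(3,4)
  proof (induction T arbitrary: w)
    case (QLeaf y)
    show ?case
      by (rule exI[of _ "QLeaf y"]) (simp add: L_avg)
  next
    case (QNode h T0 T1)
    have h: "aff (U \<union> Z) h" and T01: "over (U \<union> Z) T0" "over (U \<union> Z) T1"
      using QNode.prems by auto
    show ?case
    proof (cases "\<exists>i\<in>U. flips h i")
      case False
      have "aff ((U \<union> Z) - U) h"
        using aff_no_flips[OF h U(1)] False by blast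
      then have hZ: "aff Z h"
        by (rule aff_mono) auto
      have hz: "h x = h z" if "\<And>i. i \<notin> U \<Longrightarrow> x i = z i" for x z
        using U(2) that by (intro aff_cong_on[OF hZ]) auto
      \<comment> \<open>Splitting the weight by the answer lets the induction hypotheses for both
        subtrees be added.\<close>
      define w0 where "w0 z = (if h z then 0 else w z)" for z
      define w1 where "w1 z = (if h z then w z else 0)" for z
      have w01: "0 \<le> w0 z" "0 \<le> w1 z" for z
        using QNode.prems(2) by (auto simp: w0_def w1_def)
      obtain T0' where T0': "over Z T0'"
        "avg p Z (\<lambda>z. w0 z * (L z (qrun T0' z) + \<gamma> * qcost T0' z)) z0 \<le>
         avg p Z (\<lambda>z. w0 z * \<Phi> U T0 z) z0"
        using QNode.IH(1)[OF T01(1), of w0, OF w01(1)] unfolding \<Phi>_def by (elim exE conjE)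
      obtain T1' where T1': "over Z T1'"
        "avg p Z (\<lambda>z. w1 z * (L z (qrun T1' z) + \<gamma> * qcost T1' z)) z0 \<le>
         avg p Z (\<lambda>z. w1 z * \<Phi> U T1 z) z0"
        using QNode.IH(2)[OF T01(2), of w1, OF w01(2)] unfolding \<Phi>_def by (elim exE conjE)
      have \<Phi>: "\<Phi> U (QNode h T0 T1) z = \<gamma> + (if h z then \<Phi> U T1 z else \<Phi> U T0 z)" for z
      proof -
        have "avg p U (\<lambda>x. L x (qrun (QNode h T0 T1) x) + \<gamma> * qcost (QNode h T0 T1) x) z =
           avg p U (\<lambda>x. \<gamma> + (L x (qrun (if h z then T1 else T0) x) + \<gamma> * qcost (if h z then T1 else T0) x)) z"
        proof (rule avg_cong)
          fix x assume "\<And>i. i \<notin> U \<Longrightarrow> x i = z i"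
          then have "h x = h z"
            by (rule hz)
          then show "L x (qrun (QNode h T0 T1) x) + \<gamma> * qcost (QNode h T0 T1) x =
              \<gamma> + (L x (qrun (if h z then T1 else T0) x) + \<gamma> * qcost (if h z then T1 else T0) x)"
            by (simp add: distrib_left)
        qed
        then show ?thesis
          using False unfolding \<Phi>_def by (simp add: avg_add[OF U(1)] pivots.simps(2))
      qed
      have "avg p Z (\<lambda>z. w z * (L z (qrun (QNode h T0' T1') z) + \<gamma> * qcost (QNode h T0' T1') z)) z0 =
        avg p Z (\<lambda>z. w z * \<gamma> + (w0 z * (L z (qrun T0' z) + \<gamma> * qcost T0' z) +
           w1 z * (L z (qrun T1' z) + \<gamma> * qcost T1' z))) z0"
        by (rule avg_cong) (simp add: algebra_simps w0_def w1_def)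
      also have "\<dots> \<le> avg p Z (\<lambda>z. w z * \<gamma> + (w0 z * \<Phi> U T0 z +
           w1 z * \<Phi> U T1 z)) z0"
        using T0'(2) T1'(2) by (simp add: avg_add[OF fin(2)] del: avg_mult)
      also have "\<dots> = avg p Z (\<lambda>z. w z * \<Phi> U (QNode h T0 T1) z) z0"
        by (rule avg_cong) (simp add: \<Phi> algebra_simps w0_def w1_def)
      finally show ?thesis
        using hZ T0'(1) T1'(1) unfolding \<Phi>_def by (intro exI[of _ "QNode h T0' T1'"]) auto
    next
      case True
      define i where "i = (LEAST i. i \<in> U \<and> flips h i)"
      have i: "i \<in> U" "flips h i"
        using pivot_choice[OF True] by (simp_all add: i_def)
      define V where "V = U - {i}"
      define Ta where "Ta = qsubst (\<lambda>x. x(i := False)) (QNode h T0 T1)"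
      define Tb where "Tb = qsubst (\<lambda>x. x(i := h (x(i := False)))) T0"
      define Tc where "Tc = qsubst (\<lambda>x. x(i := (\<not> h (x(i := False))))) T1"
      have V: "card V < card U" "finite V" "V \<inter> Z = {}"
        using U card_Diff1_less[OF U(1) i(1)] by (auto simp: V_def)
      have VZ: "V \<union> Z = U \<union> Z - {i}"
        using i(1) U(2) by (auto simp: V_def)
      have g: "aff (U \<union> Z - {i}) (\<lambda>x. h (x(i := False)))"
        by (intro aff_upd h aff_const)
      then have g': "aff (U \<union> Z - {i}) (\<lambda>x. \<not> h (x(i := False)))"
        using aff_not[of _ "\<lambda>x. h (x(i := False))" True] by simp
      have T: "over (V \<union> Z) Ta" "over (V \<union> Z) Tb" "over (V \<union> Z) Tc"
        unfolding Ta_def Tb_def Tc_def VZ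
        by (rule over_upd[OF QNode.prems(1) aff_const] over_upd[OF T01(1) g] over_upd[OF T01(2) g'])+
      have ex: "\<exists>T'. over Z T' \<and>
          avg p Z (\<lambda>z. w z * (L z (qrun T' z) + \<gamma> * qcost T' z)) z0 \<le> avg p Z (\<lambda>z. w z * \<Phi> V T z) z0"
        if "over (V \<union> Z) T" for T
        unfolding \<Phi>_def
        using V(1) V(2) V(3) that
      proof (rule IH)
        show "0 \<le> w z" for z
          using QNode.prems(2) .
        show "L (x(j := b)) y = L x y" if "j \<in> V" for x y j b
          using L[of j] that by (auto simp: V_def)
        show "\<not> z0 j" if "j \<in> V" for j
          using z0[of j] that by (auto simp: V_def)
      qed
      have Li: "L (x(i := b)) y = L x y" for x b y
        using L[OF i(1)] .
      \<comment> \<open>Only points with bit \<open>i\<close> equal to 0 matter: \<open>i\<close> is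
        outside \<open>Z\<close>, so in the average over \<open>Z\<close> this bit is always that of
        \<open>z0\<close>.\<close>
      have \<Phi>: "\<Phi> U (QNode h T0 T1) z = (1 - 2 * p i) * \<Phi> V Ta z + p i * \<Phi> V Tb z + p i * \<Phi> V Tc z"
        if "\<not> z i" for z
      proof -
        have z: "z(i := False) = z"
          using that by (intro fun_upd_idem) simp
        have piv: "pivots p U (QNode h T0 T1) z = (1 - 2 * p i) * pivots p V Ta z +
            p i * (1 + pivots p V Tb z) + p i * (1 + pivots p V Tc z)"
          using True U(1) unfolding pivots.simps(2) Let_def i_def[symmetric] V_def Ta_def Tb_def Tc_def z by auto
        define \<psi> where "\<psi> x = L x (qrun (QNode h T0 T1) x) + \<gamma> * qcost (QNode h T0 T1) x" for x
        have b: "\<psi> (x(i := h (x(i := False)))) = \<gamma> + (L x (qrun Tb x) + \<gamma> * qcost Tb x)" for x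
          using flips_upd[OF i(2), of x "h (x(i := False))"]
          by (simp add: \<psi>_def Tb_def Li algebra_simps)
        have c: "\<psi> (x(i := (\<not> h (x(i := False))))) = \<gamma> + (L x (qrun Tc x) + \<gamma> * qcost Tc x)" for x
          using flips_upd[OF i(2), of x "\<not> h (x(i := False))"]
          by (simp add: \<psi>_def Tc_def Li algebra_simps)
        have a: "avg p V \<psi> z = avg p V (\<lambda>x. L x (qrun Ta x) + \<gamma> * qcost Ta x) z"
        proof (rule avg_cong)
          fix x assume "\<And>j. j \<notin> V \<Longrightarrow> x j = z j"
          then have "x i = z i"
            by (simp add: V_def)
          then have "x(i := False) = x"
            using that by (intro fun_upd_idem) simp
          then show "\<psi> x = L x (qrun Ta x) + \<gamma> * qcost Ta x"
            by (simp add: \<psi>_def Ta_def)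
        qed
        have "avg p U \<psi> z = (1 - 2 * p i) * avg p V (\<lambda>x. L x (qrun Ta x) + \<gamma> * qcost Ta x) z +
            p i * avg p V (\<lambda>x. \<gamma> + (L x (qrun Tb x) + \<gamma> * qcost Tb x)) z +
            p i * avg p V (\<lambda>x. \<gamma> + (L x (qrun Tc x) + \<gamma> * qcost Tc x)) z"
          unfolding avg_free[OF U(1) i(1) p(1), of \<psi> z "\<lambda>x. h (x(i := False))"] b c z
          unfolding V_def[symmetric] a ..
        then show ?thesis
          unfolding \<Phi>_def \<psi>_def[symmetric] piv avg_add[OF V(2), of p "\<lambda>_. \<gamma>"] avg_const
          by (simp add: algebra_simps)
      qed
      have "avg p Z (\<lambda>z. w z * \<Phi> U (QNode h T0 T1) z) z0 =
          avg p Z (\<lambda>z. (1 - 2 * p i) * (w z * \<Phi> V Ta z) + p i * (w z * \<Phi> V Tb z) + p i * (w z * \<Phi> V Tc z)) z0"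
      proof (rule avg_cong)
        fix z assume "\<And>j. j \<notin> Z \<Longrightarrow> z j = z0 j"
        then have "\<not> z i"
          using i(1) U(2) z0[OF i(1)] by auto
        show "w z * \<Phi> U (QNode h T0 T1) z =
            (1 - 2 * p i) * (w z * \<Phi> V Ta z) + p i * (w z * \<Phi> V Tb z) + p i * (w z * \<Phi> V Tc z)"
          unfolding \<Phi>[of z, OF \<open>\<not> z i\<close>] by (simp add: algebra_simps)
      qed
      also have "\<dots> = (1 - 2 * p i) * avg p Z (\<lambda>z. w z * \<Phi> V Ta z) z0 +
          p i * avg p Z (\<lambda>z. w z * \<Phi> V Tb z) z0 + p i * avg p Z (\<lambda>z. w z * \<Phi> V Tc z) z0"
        by (simp add: avg_add[OF fin(2)])
      finally have eq: "avg p Z (\<lambda>z. w z * \<Phi> U (QNode h T0 T1) z) z0 = \<dots>" .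
      have "0 \<le> p i"
        using p(1) by (simp add: biases_def)
      define R where "R T = avg p Z (\<lambda>z. w z * \<Phi> V T z) z0" for T
      \<comment> \<open>The comparison is made after averaging over \<open>Z\<close>, so a single
        choice serves all \<open>z\<close>.\<close>
      obtain T' where T': "over (V \<union> Z) T'" "R T' \<le> (1 - 2 * p i) * R Ta + p i * R Tb + p i * R Tc"
        using min_le_mix[OF \<open>0 \<le> p i\<close> p(2), of "R Ta" "R Tb" "R Tc"] T by blast
      obtain T'' where T'': "over Z T''"
        "avg p Z (\<lambda>z. w z * (L z (qrun T'' z) + \<gamma> * qcost T'' z)) z0 \<le> R T'"
        using ex[OF T'(1)] unfolding R_def by blast
      have "R T' \<le> avg p Z (\<lambda>z. w z * \<Phi> U (QNode h T0 T1) z) z0"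
        using T'(2) unfolding eq R_def .
      from order_trans[OF T''(2) this] T''(1) have "\<exists>T'. over Z T' \<and>
          avg p Z (\<lambda>z. w z * (L z (qrun T' z) + \<gamma> * qcost T' z)) z0 \<le>
          avg p Z (\<lambda>z. w z * \<Phi> U (QNode h T0 T1) z) z0"
        by (intro exI[of _ T''] conjI)
      then show ?thesis
        unfolding \<Phi>_def .
    qed
  qed
qed

section \<open>Search for the first one\<close>

primrec par :: "nat list \<Rightarrow> (nat \<Rightarrow> bool) \<Rightarrow> bool" where
  "par [] x \<longleftrightarrow> False"
| "par (i # l) x \<longleftrightarrow> x i \<noteq> par l x"

lemma par_append: "par (l @ l') x \<longleftrightarrow> par l x \<noteq> par l' x"
  by (induction l) auto

lemma aff_par: "set l \<subseteq> U \<Longrightarrow> aff U (par l)"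
proof (induction l)
  case Nil
  have "par [] = (\<lambda>x. False)"
    by (rule ext) simp
  then show ?case
    using aff_const[of U False] by simp
next
  case (Cons i l)
  then have "aff U (\<lambda>x. x i \<noteq> par l x)"
    by (intro aff_xor aff_coord) auto
  then show ?case
    by simp
qed

text \<open>The value is \<open>length l\<close> if all listed bits are 0. Truncating a list
  therefore amounts to stopping at that position.\<close>

definition first :: "nat list \<Rightarrow> (nat \<Rightarrow> bool) \<Rightarrow> nat" where
  "first l x = length (takeWhile (\<lambda>i. \<not> x i) l)"

definition hits :: "nat list \<Rightarrow> (nat \<Rightarrow> bool) \<Rightarrow> nat" where
  "hits l x = length (filter x l)"

lemma hits_0_first: "hits l x = 0 \<Longrightarrow> first l x = length l"
  unfolding hits_def first_def by (induction l) (auto split: if_splits)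

lemma first_takeWhile: "i \<in> set l \<Longrightarrow> x i \<Longrightarrow> first (takeWhile (\<lambda>j. j \<noteq> i) l) x = first l x"
  unfolding first_def by (induction l) auto

text \<open>Continuing in front of a 1 that has been found keeps the position of the first 1
  (\<open>first_takeWhile\<close>) and uses up one of the ones. This pays for finding it.\<close>

lemma hits_takeWhile: "i \<in> set l \<Longrightarrow> x i \<Longrightarrow> Suc (hits (takeWhile (\<lambda>j. j \<noteq> i) l) x) \<le> hits l x"
  unfolding hits_def by (induction l) auto

lemma length_takeWhile_neq: "i \<in> set l \<Longrightarrow> length (takeWhile (\<lambda>j. j \<noteq> i) l) < length l"
  by (induction l) auto

text \<open>Binary search: of two halves of a list of odd parity exactly one has odd parity.\<close>

lemma binary_search:
  assumes "l \<noteq> []" "length l \<le> 2 ^ e" "set l \<subseteq> U"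
  shows "\<exists>B. over U B \<and> (\<forall>x. qcost B x \<le> e) \<and> (\<forall>x. par l x \<longrightarrow> qrun B x \<in> set l \<and> x (qrun B x))"
  using assms
proof (induction e arbitrary: l)
  case 0
  then obtain i where "l = [i]"
    by (cases l) auto
  then show ?case
    by (intro exI[of _ "QLeaf i"]) auto
next
  case (Suc e)
  define l1 where "l1 = take (2 ^ e) l"
  define l2 where "l2 = drop (2 ^ e) l"
  have l: "l = l1 @ l2"
    by (simp add: l1_def l2_def)
  have "l1 \<noteq> []" "length l1 \<le> 2 ^ e" "set l1 \<subseteq> U"
    using Suc.prems set_take_subset[of "2 ^ e" l] by (auto simp: l1_def)
  from Suc.IH[OF this] obtain B1 where B1: "over U B1" "\<And>x. qcost B1 x \<le> e"
    "\<And>x. par l1 x \<Longrightarrow> qrun B1 x \<in> set l1 \<and> x (qrun B1 x)"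
    by blast
  show ?case
  proof (cases "l2 = []")
    case True
    then show ?thesis
      using B1 l by (intro exI[of _ B1]) (auto intro: le_SucI)
  next
    case False
    have "length l2 \<le> 2 ^ e" "set l2 \<subseteq> U"
      using Suc.prems set_drop_subset[of "2 ^ e" l] by (auto simp: l2_def)
    from Suc.IH[OF False this] obtain B2 where B2: "over U B2" "\<And>x. qcost B2 x \<le> e"
      "\<And>x. par l2 x \<Longrightarrow> qrun B2 x \<in> set l2 \<and> x (qrun B2 x)"
      by blast
    show ?thesis
      using B1 B2 aff_par[OF \<open>set l1 \<subseteq> U\<close>]
      by (intro exI[of _ "QNode (par l1) B2 B1"]) (auto simp: l par_append)
  qed
qed

text \<open>
  A random sublist of \<open>l\<close> has odd parity with probability 1/2 on every input that hits \<open>l\<close>.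
\<close>

lemma parity_test:
  assumes "finite U"
  shows "\<exists>r. set r \<subseteq> set l \<and> length r \<le> length l \<and>
    avg p U (\<lambda>x. if par r x then \<beta> x else \<alpha> x) z \<le>
    avg p U (\<lambda>x. if hits l x = 0 then \<alpha> x else (\<alpha> x + \<beta> x) / 2) z"
proof (induction l arbitrary: \<alpha> \<beta>)
  case Nil
  show ?case
    by (intro exI[of _ "[]"]) (simp add: hits_def)
next
  case (Cons i l)
  \<comment> \<open>If \<open>x i\<close> holds, exactly one of \<open>r\<close> and
    \<open>i # r\<close> has odd parity, so together they contribute
    \<open>\<alpha> x + \<beta> x\<close>. Otherwise both have the same parity. Hence the better of
    the two is good enough.\<close>
  define \<alpha>' where "\<alpha>' x = (if x i then (\<alpha> x + \<beta> x) / 2 else \<alpha> x)" for x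
  define \<beta>' where "\<beta>' x = (if x i then (\<alpha> x + \<beta> x) / 2 else \<beta> x)" for x
  obtain r where r: "set r \<subseteq> set l" "length r \<le> length l"
    "avg p U (\<lambda>x. if par r x then \<beta>' x else \<alpha>' x) z \<le>
     avg p U (\<lambda>x. if hits l x = 0 then \<alpha>' x else (\<alpha>' x + \<beta>' x) / 2) z"
    using Cons.IH[of \<beta>' \<alpha>'] by blast
  let ?F = "\<lambda>r. avg p U (\<lambda>x. if par r x then \<beta> x else \<alpha> x) z"
  let ?G = "avg p U (\<lambda>x. if hits (i # l) x = 0 then \<alpha> x else (\<alpha> x + \<beta> x) / 2) z"
  have "?F r + ?F (i # r) = avg p U (\<lambda>x. 2 * (if par r x then \<beta>' x else \<alpha>' x)) z"
    by (subst avg_add[OF assms, symmetric], rule avg_cong) (auto simp: \<alpha>'_def \<beta>'_def)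
  also have "\<dots> = 2 * avg p U (\<lambda>x. if par r x then \<beta>' x else \<alpha>' x) z"
    by simp
  also have "\<dots> \<le> 2 * avg p U (\<lambda>x. if hits l x = 0 then \<alpha>' x else (\<alpha>' x + \<beta>' x) / 2) z"
    using r(3) by simp
  also have "avg p U (\<lambda>x. if hits l x = 0 then \<alpha>' x else (\<alpha>' x + \<beta>' x) / 2) z = ?G"
    by (rule avg_cong) (auto simp: \<alpha>'_def \<beta>'_def hits_def)
  finally have "?F r \<le> ?G \<or> ?F (i # r) \<le> ?G"
    by linarith
  moreover have "set r \<subseteq> set (i # l)" "length r \<le> length (i # l)"
    "set (i # r) \<subseteq> set (i # l)" "length (i # r) \<le> length (i # l)"
    using r by auto
  ultimately show ?case
    by blast
qed

text \<open>Parities of random sublists are tested. After \<open>M\<close> even ones the list is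
  taken to contain no 1. After an odd one, binary search finds a 1 with \<open>e\<close> queries,
  and the search restarts with \<open>N\<close> tests in front of it. Each 1 thus pays for one
  restart, with error \<open>(1/2) ^ N\<close> and \<open>N + e\<close> queries. The weight
  \<open>w\<close> restricts the claim to the inputs that reach a node.\<close>

lemma search_first:
  fixes \<gamma> :: real
  assumes U: "finite U" and \<gamma>: "0 \<le> \<gamma>" and l: "set l \<subseteq> U" "length l \<le> 2 ^ e" and w: "\<And>x. 0 \<le> w x"
  shows "\<exists>Q. over U Q \<and>
    avg p U (\<lambda>x. w x * (of_bool (qrun Q x \<noteq> first l x) + \<gamma> * qcost Q x)) z \<le>
    avg p U (\<lambda>x. w x * (of_bool (hits l x \<noteq> 0) * (1/2) ^ M + \<gamma> * M +
      hits l x * ((1/2) ^ N + \<gamma> * (real N + real e)))) z"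
  using l w
proof (induction "length l" arbitrary: l w M rule: less_induct)
  case less
  note IH = less.hyps
  note l = less.prems(1,2)
  define \<kappa> where "\<kappa> = (1/2) ^ N + \<gamma> * (real N + real e)"
  define val where "val l Q x = of_bool (qrun Q x \<noteq> first l x) + \<gamma> * qcost Q x" for l Q x
  define bd where "bd l M x = of_bool (hits l x \<noteq> 0) * (1/2) ^ M + \<gamma> * real M + hits l x * \<kappa>" for l M x
  have \<kappa>: "0 \<le> \<kappa>"
    using \<gamma> by (simp add: \<kappa>_def)
  have "\<exists>Q. over U Q \<and> avg p U (\<lambda>x. w x * val l Q x) z \<le> avg p U (\<lambda>x. w x * bd l M x) z"
    using less.prems(3)
  proof (induction M arbitrary: w)
    case 0
    have "avg p U (\<lambda>x. w x * val l (QLeaf (length l)) x) z \<le> avg p U (\<lambda>x. w x * bd l 0 x) z"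
      using \<kappa> by (intro avg_mono[OF U] mult_left_mono[OF _ 0]) (auto simp: val_def bd_def hits_0_first of_bool_def)
    then show ?case
      by (intro exI[of _ "QLeaf (length l)"]) auto
  next
    case (Suc M)
    \<comment> \<open>The two alternatives bound the loss after an odd and after an even parity. In
      the odd case \<open>\<gamma>\<close> is the test itself, while binary search and restart are
      covered by \<open>hits l x * \<kappa>\<close>.\<close>
    obtain r where r: "set r \<subseteq> set l" "length r \<le> length l"
      "avg p U (\<lambda>x. if par r x then w x * (\<gamma> + hits l x * \<kappa>) else w x * (\<gamma> + bd l M x)) z \<le>
       avg p U (\<lambda>x. if hits l x = 0 then w x * (\<gamma> + bd l M x)
         else (w x * (\<gamma> + bd l M x) + w x * (\<gamma> + hits l x * \<kappa>)) / 2) z"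
      using parity_test[OF U, of l p "\<lambda>x. w x * (\<gamma> + hits l x * \<kappa>)" "\<lambda>x. w x * (\<gamma> + bd l M x)" z] by blast
    have "\<dots> \<le> avg p U (\<lambda>x. w x * bd l (Suc M) x) z"
    proof (rule avg_mono[OF U])
      fix x
      have "w x * (\<gamma> + bd l M x) \<le> w x * bd l (Suc M) x" if "hits l x = 0"
        using that by (simp add: bd_def algebra_simps)
      moreover have "w x * (2 * \<gamma> + bd l M x + hits l x * \<kappa>) / 2 \<le> w x * bd l (Suc M) x" if "hits l x \<noteq> 0"
      proof -
        have "2 * \<gamma> + bd l M x + hits l x * \<kappa> \<le> 2 * bd l (Suc M) x"
          using that \<gamma> by (simp add: bd_def algebra_simps)
        then show ?thesis
          using mult_left_mono[OF _ Suc.prems(1)[of x], of "2 * \<gamma> + bd l M x + hits l x * \<kappa>" "2 * bd l (Suc M) x"]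
          by simp
      qed
      ultimately show "(if hits l x = 0 then w x * (\<gamma> + bd l M x)
         else (w x * (\<gamma> + bd l M x) + w x * (\<gamma> + hits l x * \<kappa>)) / 2) \<le> w x * bd l (Suc M) x"
        by (simp add: algebra_simps)
    qed
    note r_bd = order_trans[OF r(3) this]
    have "0 \<le> (if par r x then 0 else w x)" for x
      using Suc.prems by simp
    from Suc.IH[of "\<lambda>x. if par r x then 0 else w x", OF this] obtain Q0 where Q0: "over U Q0"
      "avg p U (\<lambda>x. (if par r x then 0 else w x) * val l Q0 x) z \<le>
       avg p U (\<lambda>x. (if par r x then 0 else w x) * bd l M x) z"
      by blast
    have "\<exists>B. over U B \<and> (\<forall>x. qcost B x \<le> e) \<and> (\<forall>x. par r x \<longrightarrow> qrun B x \<in> set r \<and> x (qrun B x))"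
    proof (cases "r = []")
      case True
      then show ?thesis
        by (intro exI[of _ "QLeaf 0"]) auto
    next
      case False
      then show ?thesis
        using r l by (intro binary_search) auto
    qed
    then obtain B where B: "over U B" "\<And>x. qcost B x \<le> e"
      "\<And>x. par r x \<Longrightarrow> qrun B x \<in> set l" "\<And>x. par r x \<Longrightarrow> x (qrun B x)"
      using r(1) by blast
    define li where "li i = takeWhile (\<lambda>j. j \<noteq> i) l" for i
    \<comment> \<open>The weight of the inputs on which binary search returns \<open>i\<close>. Each
      of these classes has its own continuation.\<close>
    define v where "v i x = (if par r x \<and> qrun B x = i then w x else 0)" for i x
    have "\<exists>Q. over U Q \<and> avg p U (\<lambda>x. v i x * val (li i) Q x) z \<le> avg p U (\<lambda>x. v i x * bd (li i) N x) z"
      if i: "i \<in> set l" for i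
      unfolding val_def bd_def \<kappa>_def
    proof (rule IH)
      show "length (li i) < length l"
        using length_takeWhile_neq[OF i] by (simp add: li_def)
      then show "length (li i) \<le> 2 ^ e"
        using l by simp
      show "set (li i) \<subseteq> U"
        using l by (auto simp: li_def dest: set_takeWhileD)
      show "0 \<le> v i x" for x
        using Suc.prems by (simp add: v_def)
    qed
    then obtain C' where C': "\<And>i. i \<in> set l \<Longrightarrow> over U (C' i) \<and>
        avg p U (\<lambda>x. v i x * val (li i) (C' i) x) z \<le> avg p U (\<lambda>x. v i x * bd (li i) N x) z"
      by metis
    \<comment> \<open>The default leaf only makes every continuation a tree over \<open>U\<close>.
      After an odd parity the output of \<open>B\<close> lies in \<open>set l\<close>.\<close>
    define C where "C i = (if i \<in> set l then C' i else QLeaf 0)" for i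
    have C: "over U (C i)" for i
      using C' by (simp add: C_def)
    define Q where "Q = QNode (par r) Q0 (graft B C)"
    have "over U Q"
      using aff_par[of r U] r(1) l(1) Q0(1) over_graft[OF B(1) C] by (auto simp: Q_def)
    moreover have "avg p U (\<lambda>x. w x * val l Q x) z \<le> avg p U (\<lambda>x. w x * bd l (Suc M) x) z"
    proof -
      have "avg p U (\<lambda>x. w x * val l Q x) z \<le>
          avg p U (\<lambda>x. w x * \<gamma> + ((if par r x then 0 else w x) * val l Q0 x +
            ((if par r x then w x else 0) * (\<gamma> * e) + (\<Sum>i\<in>set l. v i x * val (li i) (C' i) x)))) z"
      proof (rule avg_mono[OF U])
        fix x
        show "w x * val l Q x \<le> w x * \<gamma> + ((if par r x then 0 else w x) * val l Q0 x +
            ((if par r x then w x else 0) * (\<gamma> * e) + (\<Sum>i\<in>set l. v i x * val (li i) (C' i) x)))"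
        proof (cases "par r x")
          case False
          then have "v i x = 0" for i
            by (simp add: v_def)
          then show ?thesis
            using False by (simp add: Q_def val_def algebra_simps)
        next
          case True
          let ?i = "qrun B x"
          have "(\<Sum>i\<in>set l. v i x * val (li i) (C' i) x) =
              (\<Sum>i\<in>set l. if i = ?i then w x * val (li i) (C' i) x else 0)"
            using True by (intro sum.cong) (auto simp: v_def)
          also have "\<dots> = w x * val (li ?i) (C' ?i) x"
            using B(3)[OF True] by simp
          also have "\<dots> = w x * val l (C' ?i) x"
            using first_takeWhile[of ?i l x] B(3,4)[OF True] by (simp add: val_def li_def)
          finally have sum: "(\<Sum>i\<in>set l. v i x * val (li i) (C' i) x) = \<dots>" .
          have "val l Q x = \<gamma> + (\<gamma> * qcost B x + val l (C' ?i) x)"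
            using True B(3)[OF True] by (simp add: Q_def val_def C_def algebra_simps)
          also have "\<dots> \<le> \<gamma> + (\<gamma> * e + val l (C' ?i) x)"
            using B(2)[of x] \<gamma> by (auto intro!: mult_left_mono)
          finally have "w x * val l Q x \<le> w x * (\<gamma> + (\<gamma> * e + val l (C' ?i) x))"
            by (rule mult_left_mono[OF _ Suc.prems])
          then show ?thesis
            unfolding sum using True by (simp add: algebra_simps)
        qed
      qed
      also have "\<dots> = avg p U (\<lambda>x. w x * \<gamma>) z + (avg p U (\<lambda>x. (if par r x then 0 else w x) * val l Q0 x) z +
         (avg p U (\<lambda>x. (if par r x then w x else 0) * (\<gamma> * e)) z +
          (\<Sum>i\<in>set l. avg p U (\<lambda>x. v i x * val (li i) (C' i) x) z)))"
        by (simp only: avg_add[OF U] avg_sum[OF U])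
      also have "\<dots> \<le> avg p U (\<lambda>x. w x * \<gamma>) z + (avg p U (\<lambda>x. (if par r x then 0 else w x) * bd l M x) z +
         (avg p U (\<lambda>x. (if par r x then w x else 0) * (\<gamma> * e)) z +
          (\<Sum>i\<in>set l. avg p U (\<lambda>x. v i x * bd (li i) N x) z)))"
        using C' Q0(2) by (intro add_left_mono add_mono sum_mono order_refl) auto
      also have "\<dots> = avg p U (\<lambda>x. w x * \<gamma> + ((if par r x then 0 else w x) * bd l M x +
            ((if par r x then w x else 0) * (\<gamma> * e) + (\<Sum>i\<in>set l. v i x * bd (li i) N x)))) z"
        by (simp only: avg_add[OF U] avg_sum[OF U])
      also have "\<dots> \<le> avg p U (\<lambda>x. if par r x then w x * (\<gamma> + hits l x * \<kappa>) else w x * (\<gamma> + bd l M x)) z"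
      proof (rule avg_mono[OF U])
        fix x
        show "w x * \<gamma> + ((if par r x then 0 else w x) * bd l M x +
            ((if par r x then w x else 0) * (\<gamma> * e) + (\<Sum>i\<in>set l. v i x * bd (li i) N x))) \<le>
            (if par r x then w x * (\<gamma> + hits l x * \<kappa>) else w x * (\<gamma> + bd l M x))"
        proof (cases "par r x")
          case False
          then have "v i x = 0" for i
            by (simp add: v_def)
          then show ?thesis
            using False by (simp add: algebra_simps)
        next
          case True
          let ?i = "qrun B x"
          have "(\<Sum>i\<in>set l. v i x * bd (li i) N x) =
              (\<Sum>i\<in>set l. if i = ?i then w x * bd (li i) N x else 0)"
            using True by (intro sum.cong) (auto simp: v_def)
          also have "\<dots> = w x * bd (li ?i) N x"
            using B(3)[OF True] by simp
          finally have sum: "(\<Sum>i\<in>set l. v i x * bd (li i) N x) = \<dots>" .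
          have "Suc (hits (li ?i) x) \<le> hits l x"
            unfolding li_def by (rule hits_takeWhile) (use B(3,4)[OF True] in auto)
          then have "real (hits (li ?i) x) + 1 \<le> hits l x"
            by simp
          then have "(real (hits (li ?i) x) + 1) * \<kappa> \<le> hits l x * \<kappa>"
            using \<kappa> by (rule mult_right_mono)
          moreover have "\<gamma> * e + bd (li ?i) N x \<le> (real (hits (li ?i) x) + 1) * \<kappa>"
            by (simp add: bd_def \<kappa>_def algebra_simps of_bool_def)
          ultimately have "w x * (\<gamma> + (\<gamma> * e + bd (li ?i) N x)) \<le> w x * (\<gamma> + hits l x * \<kappa>)"
            using Suc.prems[of x] by (intro mult_left_mono) auto
          then show ?thesis
            unfolding sum using True by (simp add: algebra_simps)
        qed
      qed
      also note r_bd
      finally show ?thesis .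
    qed
    ultimately show ?case
      by blast
  qed
  then show ?case
    unfolding val_def bd_def \<kappa>_def .
qed

section \<open>Simulation on a single block\<close>

lemma over_cong:
  assumes "over U T" "\<And>i. i \<in> U \<Longrightarrow> x i = y i"
  shows "qrun T x = qrun T y" "qcost T x = qcost T y"
proof -
  have "qrun T x = qrun T y \<and> qcost T x = qcost T y"
    using assms(1)
  proof (induction T)
    case (QNode h T0 T1)
    then have "h x = h y"
      by (intro aff_cong_on[of U h]) (auto simp: assms(2))
    with QNode show ?case
      by simp
  qed simp
  then show "qrun T x = qrun T y" "qcost T x = qcost T y"
    by auto
qed

lemma over_upd_eq:
  assumes "over (V - {i}) T"
  shows "qrun T (x(i := b)) = qrun T x" "qcost T (x(i := b)) = qcost T x"
  by (rule over_cong[OF assms]; auto)+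

text \<open>
  \<open>mix p U l \<phi> z\<close> is the expectation of \<open>\<phi> s x\<close> where \<open>s\<close> is the position of the first fair
  bit of \<open>l\<close> (a bit that is not fair is 0).
\<close>

primrec mix :: "(nat \<Rightarrow> real) \<Rightarrow> nat set \<Rightarrow> nat list \<Rightarrow> (nat \<Rightarrow> (nat \<Rightarrow> bool) \<Rightarrow> real) \<Rightarrow>
    (nat \<Rightarrow> bool) \<Rightarrow> real" where
  "mix p U [] \<phi> z = avg p U (\<phi> 0) z"
| "mix p U (i # l) \<phi> z = (1 - 2 * p i) * mix p (U - {i}) l (\<lambda>s. \<phi> (Suc s)) (z(i := False)) +
    p i * (avg p (U - {i}) (\<phi> 0) (z(i := True)) + avg p (U - {i}) (\<phi> 0) (z(i := False)))"

text \<open>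
  Whether a bit with value 0 is fair is decided by an extra coin; \<open>m\<close> is the best position of the
  first success among these coins.
\<close>

lemma mix_stopping:
  assumes "finite U" "distinct l" "set l \<subseteq> U" "biases p" "\<And>i. p i \<le> 1/2"
  shows "\<exists>m. avg p U (\<lambda>x. \<phi> (first (take m l) x) x) z \<le> mix p U l \<phi> z"
  using assms(1-3)
proof (induction l arbitrary: U \<phi> z)
  case Nil
  show ?case
    by (rule exI[of _ 0]) (simp add: first_def)
next
  case (Cons i l)
  define V where "V = U - {i}"
  have V: "finite V" "i \<notin> V" "U = insert i V"
    using Cons.prems by (auto simp: V_def)
  have pi: "0 \<le> p i" "p i \<le> 1"
    using assms(4) by (auto simp: biases_def)
  let ?t = "avg p V (\<phi> 0) (z(i := True))" and ?f = "avg p V (\<phi> 0) (z(i := False))"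
  let ?m = "mix p V l (\<lambda>s. \<phi> (Suc s)) (z(i := False))"
  have mix: "mix p U (i # l) \<phi> z = (1 - 2 * p i) * ?m + p i * (?t + ?f)"
    by (simp add: V_def)
  \<comment> \<open>When bit \<open>i\<close> is 0, the coin chooses between stopping (value
    \<open>?f\<close>) and going on (value \<open>?m\<close>), and the better of the two replaces
    it. Stopping is realised by truncating the list.\<close>
  show ?case
  proof (cases "?f \<le> ?m")
    case True
    then have "(1 - 2 * p i) * ?f \<le> (1 - 2 * p i) * ?m"
      using assms(5)[of i] by (intro mult_left_mono) auto
    then have "p i * ?t + (1 - p i) * ?f \<le> mix p U (i # l) \<phi> z"
      unfolding mix by (simp add: algebra_simps)
    moreover have "avg p U (\<lambda>x. \<phi> (first (take 0 (i # l)) x) x) z = p i * ?t + (1 - p i) * ?f"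
      unfolding V(3) by (simp add: first_def avg_insert[of V i p, OF V(1,2) pi])
    ultimately show ?thesis
      by metis
  next
    case False
    have "distinct l" "set l \<subseteq> V"
      using Cons.prems by (auto simp: V_def)
    from Cons.IH[OF V(1) this, of "\<lambda>s. \<phi> (Suc s)" "z(i := False)"] obtain m where
      m: "avg p V (\<lambda>x. \<phi> (Suc (first (take m l) x)) x) (z(i := False)) \<le> ?m"
      by blast
    have "avg p V (\<lambda>x. \<phi> (first (take (Suc m) (i # l)) x) x) (z(i := True)) = ?t"
      using V(2) by (intro avg_cong) (simp add: first_def)
    moreover have "avg p V (\<lambda>x. \<phi> (first (take (Suc m) (i # l)) x) x) (z(i := False)) =
        avg p V (\<lambda>x. \<phi> (Suc (first (take m l) x)) x) (z(i := False))"
      using V(2) by (intro avg_cong) (simp add: first_def)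
    ultimately have "avg p U (\<lambda>x. \<phi> (first (take (Suc m) (i # l)) x) x) z =
        p i * ?t + (1 - p i) * avg p V (\<lambda>x. \<phi> (Suc (first (take m l) x)) x) (z(i := False))"
      unfolding V(3) avg_insert[of V i p, OF V(1,2) pi] by simp
    also have "\<dots> \<le> p i * ?t + (1 - p i) * ?m"
      using m pi by (simp add: mult_left_mono)
    also have "\<dots> \<le> mix p U (i # l) \<phi> z"
      using False mult_left_mono[of ?m ?f "p i"] pi unfolding mix by (simp add: algebra_simps)
    finally show ?thesis
      by blast
  qed
qed

section \<open>Expected ones and fair bits in a list\<close>

lemma avg_coord:
  assumes "finite U" "i \<in> U" "biases p"
  shows "avg p U (\<lambda>x. of_bool (x i)) z = p i"
proof -
  have "avg p U (\<lambda>x. of_bool (x i)) z =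
      p i * avg p (U - {i}) (\<lambda>x. of_bool (x i)) (z(i := True)) +
      (1 - p i) * avg p (U - {i}) (\<lambda>x. of_bool (x i)) (z(i := False))"
    using avg_insert[of "U - {i}" i p "\<lambda>x. of_bool (x i)" z] assms
    by (simp add: insert_absorb biases_def)
  moreover have "avg p (U - {i}) (\<lambda>x. of_bool (x i)) (z(i := b)) = avg p (U - {i}) (\<lambda>_. of_bool b) (z(i := b))" for b
    by (rule avg_cong) simp
  ultimately show ?thesis
    by simp
qed

lemma avg_hits:
  assumes "finite U" "set l \<subseteq> U" "biases p"
  shows "avg p U (\<lambda>x. real (hits l x)) z = sum_list (map p l)"
  using assms(2)
proof (induction l)
  case Nil
  show ?case by (simp add: hits_def)
next
  case (Cons i l)
  have "avg p U (\<lambda>x. real (hits (i # l) x)) z = avg p U (\<lambda>x. of_bool (x i) + real (hits l x)) z"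
    by (rule avg_cong) (simp add: hits_def)
  with Cons show ?case
    using assms by (simp add: avg_add avg_coord)
qed

lemma hits_take_le: "hits (take m l) x \<le> hits l x"
proof -
  have "hits l x = hits (take m l) x + hits (drop m l) x"
    by (simp add: hits_def flip: length_append filter_append)
  then show ?thesis by simp
qed

text \<open>For distinct bits this is the probability that none of them is fair.\<close>

definition miss :: "(nat \<Rightarrow> real) \<Rightarrow> nat list \<Rightarrow> real" where
  "miss p l = prod_list (map (\<lambda>i. 1 - 2 * p i) l)"

text \<open>The product telescopes because (1 - a) (1 + a + s) \<le> 1 + s for nonnegative a and s.
  So at least \<open>\<theta>\<close> expected fair bits yield a fair bit with probability at least
  \<theta> / (1 + \<theta>).\<close>

lemma miss_bound:
  assumes "biases p" "\<And>i. p i \<le> 1/2"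
  shows "0 \<le> miss p l" "miss p l * (1 + (\<Sum>i\<leftarrow>l. 2 * p i)) \<le> 1"
proof -
  have "0 \<le> miss p l \<and> 0 \<le> (\<Sum>i\<leftarrow>l. 2 * p i) \<and> miss p l * (1 + (\<Sum>i\<leftarrow>l. 2 * p i)) \<le> 1"
  proof (induction l)
    case Nil
    show ?case by (simp add: miss_def)
  next
    case (Cons i l)
    have pi: "0 \<le> p i" "p i \<le> 1/2"
      using assms by (auto simp: biases_def)
    let ?s = "\<Sum>i\<leftarrow>l. 2 * p i"
    have "(1 - 2 * p i) * (1 + (2 * p i + ?s)) \<le> 1 + ?s"
      using pi Cons.IH by (simp add: algebra_simps)
    then have "miss p l * ((1 - 2 * p i) * (1 + (2 * p i + ?s))) \<le> miss p l * (1 + ?s)"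
      using Cons.IH by (intro mult_left_mono) auto
    then show ?case
      using Cons.IH pi by (auto simp: miss_def mult_ac intro: order_trans)
  qed
  then show "0 \<le> miss p l" "miss p l * (1 + (\<Sum>i\<leftarrow>l. 2 * p i)) \<le> 1"
    by auto
qed

text \<open>
  Because of the cap, a wrong search result costs at most 1, however bad the tree is that is used
  afterwards, and inputs on which \<open>S\<close> makes \<open>1/\<gamma>\<close> queries or more count as errors.
\<close>

definition cap_loss :: "real \<Rightarrow> ((nat \<Rightarrow> bool) \<Rightarrow> 'o \<Rightarrow> real) \<Rightarrow> 'o qtree \<Rightarrow> (nat \<Rightarrow> bool) \<Rightarrow> real" where
  "cap_loss \<gamma> L S x = min 1 (L x (qrun S x) + \<gamma> * qcost S x)"

lemma min_cost_Suc: "0 \<le> \<gamma> \<Longrightarrow> min 1 (a + \<gamma> * real (Suc c)) \<le> \<gamma> + min 1 (a + \<gamma> * real c)"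
  by (simp add: min_def distrib_left)

definition is_loss :: "((nat \<Rightarrow> bool) \<Rightarrow> 'o \<Rightarrow> real) \<Rightarrow> bool" where
  "is_loss L \<longleftrightarrow> (\<forall>x y. 0 \<le> L x y \<and> L x y \<le> 1)"

text \<open>\<open>\<gamma>\<close> is the price of a query of \<open>S\<close> and
  \<open>\<Gamma>\<close> that of a pivot of \<open>T\<close>. \<open>\<theta>\<close> pays for the
  incomplete last batch and \<open>\<delta>\<close> for the search errors of one batch; every batch
  removes a bit of \<open>U\<close>. \<open>S\<close> may use bits of \<open>V\<close> outside
  \<open>U\<close>, which are fixed by \<open>z\<close>.\<close>

definition simulates :: "(nat \<Rightarrow> real) \<Rightarrow> real \<Rightarrow> real \<Rightarrow> real \<Rightarrow> real \<Rightarrow> nat set \<Rightarrow> nat set \<Rightarrow>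
    'o qtree \<Rightarrow> ((nat \<Rightarrow> bool) \<Rightarrow> 'o \<Rightarrow> real) \<Rightarrow> (nat \<Rightarrow> bool) \<Rightarrow> 'o qtree \<Rightarrow> bool" where
  "simulates p \<gamma> \<Gamma> \<theta> \<delta> U V T L z S \<longleftrightarrow> over V S \<and>
     avg p U (cap_loss \<gamma> L S) z \<le>
     avg p U (\<lambda>x. L x (qrun T x)) z + \<theta> + real (card U) * \<delta> + \<Gamma> * pivots p U T z"

text \<open>
  Along the path of \<open>T\<close> on which no fair bit is met, the bits are collected until the expected
  number of fair ones among them reaches \<open>r\<close>, or the path ends with an output \<open>y\<close>.
\<close>

lemma batch:
  fixes T :: "'o qtree" and L :: "(nat \<Rightarrow> bool) \<Rightarrow> 'o \<Rightarrow> real" and \<gamma> \<Gamma> \<theta> \<delta> r :: real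
  assumes p: "biases p" "\<And>i. p i \<le> 1/2"
    and \<gamma>: "0 \<le> \<gamma>" and \<Gamma>: "0 \<le> \<Gamma>" and \<theta>: "0 < \<theta>" "\<theta> \<le> 1" and \<delta>: "0 \<le> \<delta>"
    and IH: "\<forall>W V (T :: 'o qtree) L z. card W < n \<longrightarrow> finite W \<longrightarrow> W \<subseteq> V \<longrightarrow> over V T \<longrightarrow> is_loss L \<longrightarrow>
      (\<exists>S. simulates p \<gamma> \<Gamma> \<theta> \<delta> W V T L z S)"
    and L: "is_loss L"
    and U: "finite U" "U \<subseteq> V" "card U \<le> n" "over V T" "0 < r"
  shows "(\<exists>y. avg p U (\<lambda>x. L x y) z \<le> avg p U (\<lambda>x. L x (qrun T x)) z + r) \<or>
    (\<exists>l C. l \<noteq> [] \<and> distinct l \<and> set l \<subseteq> U \<and> (\<forall>s. over V (C s)) \<and>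
      (\<Sum>i\<leftarrow>butlast l. 2 * p i) < r \<and> r \<le> (\<Sum>i\<leftarrow>l. 2 * p i) \<and>
      mix p U l (\<lambda>s. cap_loss \<gamma> L (C s)) z \<le>
      avg p U (\<lambda>x. L x (qrun T x)) z + \<gamma> + \<theta> + (real n - 1) * \<delta> + \<Gamma> * (pivots p U T z - (1 - miss p l)))"
  using U
proof (induction "card U" arbitrary: U V T z r rule: less_induct)
  case less
  note U = less.prems(1,2) and cardU = less.prems(3)
  show ?case
    using less.prems(4)
  proof (induction T)
    case (QLeaf y)
    show ?case
      using less.prems(5) by (intro disjI1 exI[of _ y]) auto
  next
    case (QNode h T0 T1)
    have h: "aff V h" and T01: "over V T0" "over V T1"
      using QNode.prems by auto
    show ?case
    proof (cases "\<exists>i\<in>U. flips h i")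
      case False
      \<comment> \<open>No bit of \<open>U\<close> influences this query, so \<open>z\<close>
        determines the answer and the path is followed at no cost.\<close>
      have "aff (V - U) h"
        using aff_no_flips[OF h U(1)] False by blast
      have hz: "h x = h z" if x: "\<And>i. i \<notin> U \<Longrightarrow> x i = z i" for x
        by (rule aff_cong_on[OF \<open>aff (V - U) h\<close>]) (rule x, simp)
      have avg: "avg p U (\<lambda>x. L x (qrun (QNode h T0 T1) x)) z = avg p U (\<lambda>x. L x (qrun (if h z then T1 else T0) x)) z"
      proof (rule avg_cong)
        fix x assume "\<And>i. i \<notin> U \<Longrightarrow> x i = z i"
        then have "h x = h z"
          by (rule hz)
        then show "L x (qrun (QNode h T0 T1) x) = L x (qrun (if h z then T1 else T0) x)"
          by simp
      qed
      have piv: "pivots p U (QNode h T0 T1) z = pivots p U (if h z then T1 else T0) z"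
        using False by (simp add: pivots.simps(2))
      show ?thesis
      proof (cases "h z")
        case True
        show ?thesis
          using QNode.IH(2)[OF T01(2)] unfolding avg piv if_P[OF True] .
      next
        case False
        show ?thesis
          using QNode.IH(1)[OF T01(1)] unfolding avg piv if_not_P[OF False] .
      qed
    next
      case True
      define i where "i = (LEAST i. i \<in> U \<and> flips h i)"
      have i: "i \<in> U" "flips h i"
        using pivot_choice[OF True] by (simp_all add: i_def)
      define U' where "U' = U - {i}"
      define V' where "V' = V - {i}"
      define z' where "z' = z(i := False)"
      define g where "g x = h (x(i := False))" for x
      define Ta where "Ta = qsubst (\<lambda>x. x(i := False)) (QNode h T0 T1)"
      define Tb where "Tb = qsubst (\<lambda>x. x(i := g x)) T0"
      define Tc where "Tc = qsubst (\<lambda>x. x(i := (\<not> g x))) T1"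
      \<comment> \<open>In the trees for the two answers bit \<open>i\<close> is expressed by the
        others, but the loss still refers to the original input. It is therefore composed with the
        same substitution.\<close>
      define Lb where "Lb x y = L (x(i := g x)) y" for x and y :: 'o
      define Lc where "Lc x y = L (x(i := (\<not> g x))) y" for x and y :: 'o
      define D where "D = \<theta> + (real n - 1) * \<delta>"
      have pi: "0 \<le> p i" "p i \<le> 1/2" "p i \<le> 1"
        using p by (auto simp: biases_def)
      have "card U' < card U"
        unfolding U'_def by (rule card_Diff1_less[OF U(1) i(1)])
      then have U': "card U' < card U" "finite U'" "U' \<subseteq> V'" "U' \<subseteq> U" "i \<notin> U'"
        using U by (auto simp: U'_def V'_def)
      have V': "V' \<subseteq> V"
        by (auto simp: V'_def)
      have over_V: "over V S" if "over V' S" for S :: "'o qtree"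
        using over_mono[OF that V'] .
      have cardU': "card U' < n" "card U' \<le> n"
        using U'(1) cardU by auto
      have "aff V' g"
        unfolding g_def V'_def by (intro aff_upd h aff_const)
      then have g: "aff (V - {i}) g" "aff (V - {i}) (\<lambda>x. \<not> g x)"
        using aff_not[of V' g True] by (simp_all add: V'_def)
      have T: "over V' Ta" "over V' Tb" "over V' Tc"
        unfolding Ta_def Tb_def Tc_def V'_def
        by (rule over_upd[OF QNode.prems(1) aff_const] over_upd[OF T01(1) g(1)] over_upd[OF T01(2) g(2)])+
      have L01: "0 \<le> L x y" "L x y \<le> 1" for x y
        using L by (auto simp: is_loss_def)
      have Lbc: "is_loss Lb" "is_loss Lc"
        using L01 by (auto simp: is_loss_def Lb_def Lc_def)
      let ?A = "\<lambda>\<phi>. avg p U' \<phi> z'"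
      define Aa where "Aa = ?A (\<lambda>x. L x (qrun Ta x))"
      define Ab where "Ab = ?A (\<lambda>x. Lb x (qrun Tb x))"
      define Ac where "Ac = ?A (\<lambda>x. Lc x (qrun Tc x))"
      have A: "avg p U (\<lambda>x. L x (qrun (QNode h T0 T1) x)) z = (1 - 2 * p i) * Aa + p i * Ab + p i * Ac"
      proof -
        have a: "?A (\<lambda>x. L x (qrun (QNode h T0 T1) x)) = Aa"
          unfolding Aa_def
        proof (rule avg_cong)
          fix x assume "\<And>j. j \<notin> U' \<Longrightarrow> x j = z' j"
          then have "x i = False"
            using U'(5) unfolding z'_def by (metis fun_upd_same)
          then have "x(i := False) = x"
            by (rule fun_upd_idem)
          then show "L x (qrun (QNode h T0 T1) x) = L x (qrun Ta x)"
            by (simp add: Ta_def)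
        qed
        have b: "L (x(i := g x)) (qrun (QNode h T0 T1) (x(i := g x))) = Lb x (qrun Tb x)" for x
          using flips_upd[OF i(2), of x "g x"] by (simp add: Lb_def Tb_def g_def)
        have c: "L (x(i := (\<not> g x))) (qrun (QNode h T0 T1) (x(i := (\<not> g x)))) = Lc x (qrun Tc x)" for x
          using flips_upd[OF i(2), of x "\<not> g x"] by (simp add: Lc_def Tc_def g_def)
        show ?thesis
          unfolding avg_free[OF U(1) i(1) p(1), of "\<lambda>x. L x (qrun (QNode h T0 T1) x)" z g]
            U'_def[symmetric] z'_def[symmetric] a b c Ab_def Ac_def ..
      qed
      define \<pi>a where "\<pi>a = pivots p U' Ta z'"
      define \<pi>b where "\<pi>b = pivots p U' Tb z'"
      define \<pi>c where "\<pi>c = pivots p U' Tc z'"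
      have piv: "pivots p U (QNode h T0 T1) z = (1 - 2 * p i) * \<pi>a + p i * (1 + \<pi>b) + p i * (1 + \<pi>c)"
        using True U(1) unfolding pivots.simps(2) Let_def i_def[symmetric] \<pi>a_def \<pi>b_def \<pi>c_def
          U'_def Ta_def Tb_def Tc_def g_def z'_def by auto
      \<comment> \<open>The continuations work on fewer than \<open>n\<close> bits, which leaves one
        \<open>\<delta>\<close> for the search in this batch.\<close>
      have D: "\<theta> + card U' * \<delta> \<le> D"
      proof -
        have "real (card U') \<le> real n - 1"
          using cardU' by simp
        then show ?thesis
          using \<delta> by (auto simp: D_def intro: mult_right_mono)
      qed
      obtain Sb where "simulates p \<gamma> \<Gamma> \<theta> \<delta> U' V' Tb Lb z' Sb"
        using IH[rule_format, OF cardU'(1) U'(2,3) T(2) Lbc(1)] by blast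
      then have Sb: "over V' Sb" "?A (cap_loss \<gamma> Lb Sb) \<le> Ab + D + \<Gamma> * \<pi>b"
        using D by (auto simp: simulates_def Ab_def \<pi>b_def)
      obtain Sc where "simulates p \<gamma> \<Gamma> \<theta> \<delta> U' V' Tc Lc z' Sc"
        using IH[rule_format, OF cardU'(1) U'(2,3) T(3) Lbc(2)] by blast
      then have Sc: "over V' Sc" "?A (cap_loss \<gamma> Lc Sc) \<le> Ac + D + \<Gamma> * \<pi>c"
        using D by (auto simp: simulates_def Ac_def \<pi>c_def)
      \<comment> \<open>If \<open>i\<close> is the first fair bit, the query \<open>h\<close> is
        really made, and its answer selects one of the two simulations.\<close>
      define P where "P = QNode h Sb Sc"
      have P: "over V P"
        using h over_V[OF Sb(1)] over_V[OF Sc(1)] by (simp add: P_def)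
      have PV: "p i * (avg p U' (cap_loss \<gamma> L P) (z(i := True)) + avg p U' (cap_loss \<gamma> L P) (z(i := False))) \<le>
          p i * (\<gamma> + Ab + D + \<Gamma> * \<pi>b) + p i * (\<gamma> + Ac + D + \<Gamma> * \<pi>c)"
      proof -
        have "cap_loss \<gamma> L P (x(i := g x)) \<le> \<gamma> + cap_loss \<gamma> Lb Sb x" for x
        proof -
          have "\<not> h (x(i := g x))"
            using flips_upd[OF i(2), of x "g x"] by (simp add: g_def)
          then have "qrun P (x(i := g x)) = qrun Sb x" "qcost P (x(i := g x)) = Suc (qcost Sb x)"
            unfolding P_def by (simp_all only: qrun.simps qcost.simps if_False over_upd_eq[OF Sb(1)[unfolded V'_def]])
          then show ?thesis
            unfolding cap_loss_def Lb_def using min_cost_Suc[OF \<gamma>] by metis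
        qed
        then have "?A (\<lambda>x. cap_loss \<gamma> L P (x(i := g x))) \<le> ?A (\<lambda>x. \<gamma> + cap_loss \<gamma> Lb Sb x)"
          by (intro avg_mono U'(2))
        moreover have "cap_loss \<gamma> L P (x(i := (\<not> g x))) \<le> \<gamma> + cap_loss \<gamma> Lc Sc x" for x
        proof -
          have "h (x(i := (\<not> g x)))"
            using flips_upd[OF i(2), of x "\<not> g x"] by (simp add: g_def)
          then have "qrun P (x(i := (\<not> g x))) = qrun Sc x" "qcost P (x(i := (\<not> g x))) = Suc (qcost Sc x)"
            unfolding P_def by (simp_all only: qrun.simps qcost.simps if_True over_upd_eq[OF Sc(1)[unfolded V'_def]])
          then show ?thesis
            unfolding cap_loss_def Lc_def using min_cost_Suc[OF \<gamma>] by metis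
        qed
        then have "?A (\<lambda>x. cap_loss \<gamma> L P (x(i := (\<not> g x)))) \<le> ?A (\<lambda>x. \<gamma> + cap_loss \<gamma> Lc Sc x)"
          by (intro avg_mono U'(2))
        ultimately have "avg p U' (cap_loss \<gamma> L P) (z(i := True)) + avg p U' (cap_loss \<gamma> L P) (z(i := False)) \<le>
            (\<gamma> + Ab + D + \<Gamma> * \<pi>b) + (\<gamma> + Ac + D + \<Gamma> * \<pi>c)"
          unfolding avg_fair[OF U'(2,5), of p "cap_loss \<gamma> L P" z g]
          unfolding z'_def[symmetric]
          using Sb(2) Sc(2) by (simp add: avg_add[OF U'(2)])
        then have "p i * (avg p U' (cap_loss \<gamma> L P) (z(i := True)) + avg p U' (cap_loss \<gamma> L P) (z(i := False))) \<le>
            p i * ((\<gamma> + Ab + D + \<Gamma> * \<pi>b) + (\<gamma> + Ac + D + \<Gamma> * \<pi>c))"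
          using pi(1) by (rule mult_left_mono)
        then show ?thesis
          by (simp only: distrib_left)
      qed
      have A0: "0 \<le> Ab" "0 \<le> Ac"
        unfolding Ab_def Ac_def Lb_def Lc_def by (rule avg_ge[OF U'(2) L01(1)])+
      show ?thesis
      proof (cases "r \<le> 2 * p i")
        case True
        \<comment> \<open>Bit \<open>i\<close> completes the batch. If it is not fair, the remaining
          tree is simulated from scratch.\<close>
        obtain Sa where "simulates p \<gamma> \<Gamma> \<theta> \<delta> U' V' Ta L z' Sa"
          using IH[rule_format, OF cardU'(1) U'(2,3) T(1) L] by blast
        then have Sa: "over V' Sa" "?A (cap_loss \<gamma> L Sa) \<le> Aa + D + \<Gamma> * \<pi>a"
          using D by (auto simp: simulates_def Aa_def \<pi>a_def)
        define C where "C s = (if s = 0 then P else Sa)" for s :: nat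
        have "mix p U [i] (\<lambda>s. cap_loss \<gamma> L (C s)) z =
          (1 - 2 * p i) * ?A (cap_loss \<gamma> L Sa) +
          p i * (avg p U' (cap_loss \<gamma> L P) (z(i := True)) + avg p U' (cap_loss \<gamma> L P) (z(i := False)))"
          by (simp add: C_def U'_def z'_def)
        also have "\<dots> \<le> (1 - 2 * p i) * (Aa + D + \<Gamma> * \<pi>a) +
            (p i * (\<gamma> + Ab + D + \<Gamma> * \<pi>b) + p i * (\<gamma> + Ac + D + \<Gamma> * \<pi>c))"
          using Sa(2) PV pi by (intro add_mono mult_left_mono) auto
        also have "\<dots> = ((1 - 2 * p i) * Aa + p i * Ab + p i * Ac) + 2 * p i * \<gamma> + D +
            \<Gamma> * ((1 - 2 * p i) * \<pi>a + p i * (1 + \<pi>b) + p i * (1 + \<pi>c) - (1 - miss p [i]))"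
          by (simp add: miss_def algebra_simps)
        also have "2 * p i * \<gamma> \<le> \<gamma>"
          using pi \<gamma> mult_right_mono[of "2 * p i" 1 \<gamma>] by simp
        finally have "mix p U [i] (\<lambda>s. cap_loss \<gamma> L (C s)) z \<le>
            avg p U (\<lambda>x. L x (qrun (QNode h T0 T1) x)) z + \<gamma> + \<theta> + (real n - 1) * \<delta> +
            \<Gamma> * (pivots p U (QNode h T0 T1) z - (1 - miss p [i]))"
          unfolding A piv D_def by (simp add: add.assoc)
        moreover have "over V (C s)" for s
          using P over_V[OF Sa(1)] by (simp add: C_def)
        ultimately show ?thesis
          using True i(1) less.prems(5)
          by (intro disjI2 exI[of _ "[i]"] exI[of _ C] conjI allI) (assumption | simp)+
      next
        case False
        then have r: "0 < r - 2 * p i" by simp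
        consider y where "?A (\<lambda>x. L x y) \<le> Aa + (r - 2 * p i)"
          | l C where "l \<noteq> []" "distinct l" "set l \<subseteq> U'" "\<And>s. over V' (C s)"
            "(\<Sum>i\<leftarrow>butlast l. 2 * p i) < r - 2 * p i" "r - 2 * p i \<le> (\<Sum>i\<leftarrow>l. 2 * p i)"
            "mix p U' l (\<lambda>s. cap_loss \<gamma> L (C s)) z' \<le> Aa + \<gamma> + D + \<Gamma> * (\<pi>a - (1 - miss p l))"
          using less.hyps[OF U'(1,2,3) cardU'(2) T(1) r, of z'] unfolding Aa_def \<pi>a_def D_def
          by (auto simp: add.assoc)
        then show ?thesis
        proof cases
          case 1
          have le1: "?A (\<lambda>x. L (x(i := c x)) y) \<le> 1" for c
            using avg_mono[OF U'(2), of z' "\<lambda>x. L (x(i := c x)) y" "\<lambda>_. 1" p] L01 by simp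
          \<comment> \<open>The output \<open>y\<close> is also given if bit \<open>i\<close> is
            fair. This has probability \<open>2 * p i\<close> and loss at most 1, which is absorbed
            in passing from \<open>r - 2 * p i\<close> to \<open>r\<close>.\<close>
          have "avg p U (\<lambda>x. L x y) z \<le> (1 - 2 * p i) * (Aa + (r - 2 * p i)) + p i * 1 + p i * 1"
            unfolding avg_free[OF U(1) i(1) p(1), of "\<lambda>x. L x y" z g] U'_def[symmetric] z'_def[symmetric]
            using 1 le1 pi by (intro add_mono mult_left_mono) auto
          also have "\<dots> = (1 - 2 * p i) * Aa + r - 2 * p i * (r - 2 * p i)"
            by (simp add: algebra_simps)
          also have "\<dots> \<le> (1 - 2 * p i) * Aa + p i * Ab + p i * Ac + r"
            using r pi mult_nonneg_nonneg[of "2 * p i" "r - 2 * p i"]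
              mult_nonneg_nonneg[OF pi(1) A0(1)] mult_nonneg_nonneg[OF pi(1) A0(2)] by linarith
          finally show ?thesis
            unfolding A by (intro disjI1 exI[of _ y])
        next
          case (2 l C)
          define C' where "C' s = (case s of 0 \<Rightarrow> P | Suc s \<Rightarrow> C s)" for s
          have "mix p U (i # l) (\<lambda>s. cap_loss \<gamma> L (C' s)) z =
            (1 - 2 * p i) * mix p U' l (\<lambda>s. cap_loss \<gamma> L (C s)) z' +
            p i * (avg p U' (cap_loss \<gamma> L P) (z(i := True)) + avg p U' (cap_loss \<gamma> L P) (z(i := False)))"
            by (simp add: C'_def U'_def z'_def)
          also have "\<dots> \<le> (1 - 2 * p i) * (Aa + \<gamma> + D + \<Gamma> * (\<pi>a - (1 - miss p l))) +
              (p i * (\<gamma> + Ab + D + \<Gamma> * \<pi>b) + p i * (\<gamma> + Ac + D + \<Gamma> * \<pi>c))"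
            using 2(7) PV pi by (intro add_mono mult_left_mono) auto
          also have "\<dots> = ((1 - 2 * p i) * Aa + p i * Ab + p i * Ac) + \<gamma> + D +
              \<Gamma> * ((1 - 2 * p i) * \<pi>a + p i * (1 + \<pi>b) + p i * (1 + \<pi>c) - (1 - miss p (i # l)))"
            by (simp add: miss_def algebra_simps)
          finally have "mix p U (i # l) (\<lambda>s. cap_loss \<gamma> L (C' s)) z \<le>
              avg p U (\<lambda>x. L x (qrun (QNode h T0 T1) x)) z + \<gamma> + \<theta> + (real n - 1) * \<delta> +
              \<Gamma> * (pivots p U (QNode h T0 T1) z - (1 - miss p (i # l)))"
            unfolding A piv D_def by (simp add: add.assoc)
          moreover have "over V (C' s)" for s
            using P over_V[OF 2(4)] by (cases s) (simp_all add: C'_def)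
          moreover have "distinct (i # l)" "set (i # l) \<subseteq> U"
            using 2(2,3) U'(4,5) i(1) by auto
          moreover have "(\<Sum>i\<leftarrow>butlast (i # l). 2 * p i) < r" "r \<le> (\<Sum>i\<leftarrow>i # l. 2 * p i)"
            using 2(1,5,6) by auto
          ultimately show ?thesis
            by (intro disjI2 exI[of _ "i # l"] exI[of _ C'] conjI allI) (assumption | rule list.distinct)+
        qed
      qed
    qed
  qed
qed

lemma pivots_nonneg:
  assumes "biases p" "\<And>i. p i \<le> 1/2"
  shows "0 \<le> pivots p U T z"
proof -
  have pi: "0 \<le> p i" "p i * 2 \<le> 1" for i
    using assms(1) assms(2)[of i] by (auto simp: biases_def)
  show ?thesis
    using pi
  proof (induction p U T z rule: pivots.induct)
    case (2 p U h T0 T1 z)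
    show ?case
    proof (cases "finite U \<and> (\<exists>i\<in>U. flips h i)")
      case True
      let ?i = "LEAST i. i \<in> U \<and> flips h i"
      have "0 \<le> p ?i" "0 \<le> 1 - 2 * p ?i"
        using 2(6,7)[of ?i] by auto
      then show ?thesis
        unfolding pivots.simps(2) if_P[OF True] Let_def
        by (intro add_nonneg_nonneg mult_nonneg_nonneg 2(1-3)[OF True refl 2(6,7)] zero_le_one)
    next
      case False
      then show ?thesis
        unfolding pivots.simps(2) if_not_P[OF False] using 2(4,5) 2(6,7) by simp
    qed
  qed simp
qed

text \<open>A batch is collected, its first fair bit is searched for, and the simulation continues
  with the tree belonging to the position found. The search costs \<open>2 * \<kappa>\<close> on
  average. Its error part is one \<delta>, and its queries are paid for by the pivot that the batch
  yields with probability at least \<theta> / (1 + \<theta>).\<close>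

lemma single_block:
  fixes T :: "'o qtree"
  assumes p: "biases p" "\<And>i. p i \<le> 1/2" and \<gamma>: "0 \<le> \<gamma>" and \<theta>: "0 < \<theta>" "\<theta> \<le> 1"
    and \<Gamma>: "0 \<le> \<Gamma>" "\<gamma> * (2 * (real N + real e) + 1) * (1 + \<theta>) \<le> \<Gamma> * \<theta>"
    and U: "finite U" "U \<subseteq> V" "card U \<le> 2 ^ e" and T: "over V T" and L: "is_loss L"
  shows "\<exists>S. simulates p \<gamma> \<Gamma> \<theta> (2 * (1/2) ^ N) U V T L z S"
  using U T L
proof (induction "card U" arbitrary: U V T L z rule: less_induct)
  case less
  define \<delta> :: real where "\<delta> = 2 * (1/2) ^ N"
  have \<delta>: "0 \<le> \<delta>"
    by (simp add: \<delta>_def)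
  note U = less.prems(1,2)
  note piv = pivots_nonneg[OF p, of U T z]
  have "\<forall>W V (T :: 'o qtree) L z. card W < card U \<longrightarrow> finite W \<longrightarrow> W \<subseteq> V \<longrightarrow> over V T \<longrightarrow> is_loss L \<longrightarrow>
      (\<exists>S. simulates p \<gamma> \<Gamma> \<theta> \<delta> W V T L z S)"
    unfolding \<delta>_def using less.prems(3) by (intro allI impI less.hyps) auto
  from batch[OF p \<gamma> \<Gamma>(1) \<theta> \<delta> this less.prems(5) U order_refl less.prems(4) \<theta>(1), of z]
  consider y where "avg p U (\<lambda>x. L x y) z \<le> avg p U (\<lambda>x. L x (qrun T x)) z + \<theta>"
    | l C where "l \<noteq> []" "distinct l" "set l \<subseteq> U" "\<forall>s. over V (C s)"
      "(\<Sum>i\<leftarrow>butlast l. 2 * p i) < \<theta>" "\<theta> \<le> (\<Sum>i\<leftarrow>l. 2 * p i)"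
      "mix p U l (\<lambda>s. cap_loss \<gamma> L (C s)) z \<le>
      avg p U (\<lambda>x. L x (qrun T x)) z + \<gamma> + \<theta> + (real (card U) - 1) * \<delta> + \<Gamma> * (pivots p U T z - (1 - miss p l))"
    by blast
  then show ?case
    unfolding \<delta>_def[symmetric]
  proof cases
    case (1 y)
    have "avg p U (cap_loss \<gamma> L (QLeaf y)) z \<le> avg p U (\<lambda>x. L x y) z"
      by (rule avg_mono[OF U(1)]) (simp add: cap_loss_def)
    also note 1
    finally have "avg p U (cap_loss \<gamma> L (QLeaf y)) z \<le>
        avg p U (\<lambda>x. L x (qrun T x)) z + \<theta> + card U * \<delta> + \<Gamma> * pivots p U T z"
      using piv \<Gamma>(1) \<delta> mult_nonneg_nonneg[OF \<Gamma>(1) piv] mult_nonneg_nonneg[of "real (card U)" \<delta>] by linarith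
    then show "\<exists>S. simulates p \<gamma> \<Gamma> \<theta> \<delta> U V T L z S"
      using less.prems(4) by (intro exI[of _ "QLeaf y"]) (simp add: simulates_def)
  next
    case (2 l C)
    obtain m where m: "avg p U (\<lambda>x. cap_loss \<gamma> L (C (first (take m l) x)) x) z \<le>
        mix p U l (\<lambda>s. cap_loss \<gamma> L (C s)) z"
      using mix_stopping[OF U(1) 2(2,3) p, of "\<lambda>s. cap_loss \<gamma> L (C s)" z] by blast
    define l' where "l' = take m l"
    define \<kappa> where "\<kappa> = (1/2) ^ N + \<gamma> * (real N + real e)"
    have \<kappa>: "0 \<le> \<kappa>"
      using \<gamma> by (simp add: \<kappa>_def)
    have "length l \<le> card U"
      using 2(2,3) U(1) by (metis distinct_card card_mono)
    then have l': "set l' \<subseteq> U" "length l' \<le> 2 ^ e"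
      using 2(3) less.prems(3) set_take_subset[of m l] by (auto simp: l'_def)
    obtain Q where Q: "over U Q"
      "avg p U (\<lambda>x. 1 * (of_bool (qrun Q x \<noteq> first l' x) + \<gamma> * qcost Q x)) z \<le>
       avg p U (\<lambda>x. 1 * (of_bool (hits l' x \<noteq> 0) * (1/2) ^ N + \<gamma> * N + hits l' x * \<kappa>)) z"
      using search_first[OF U(1) \<gamma> l', of "\<lambda>_. 1" p z N N] unfolding \<kappa>_def by auto
    \<comment> \<open>Before the last bit fewer than \<open>\<theta>\<close> \<le> 1 fair bits are
      expected, and the last bit adds at most 1. As a fair bit is 1 half of the time, at most one 1
      is expected.\<close>
    have hits: "avg p U (\<lambda>x. real (hits l x)) z \<le> 1"
    proof -
      have "l = butlast l @ [last l]"
        using 2(1) by simp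
      then have "(\<Sum>i\<leftarrow>l. 2 * p i) = (\<Sum>i\<leftarrow>butlast l. 2 * p i) + 2 * p (last l)"
        by (metis (no_types, lifting) map_append sum_list_append list.simps(8,9) sum_list_simps add_0_right sum_list.Cons sum_list.Nil)
      also have "\<dots> \<le> 2"
        using 2(5) \<theta> p(2)[of "last l"] by simp
      finally show ?thesis
        unfolding avg_hits[OF U(1) 2(3) p(1)] by (simp add: sum_list_const_mult)
    qed
    have search: "avg p U (\<lambda>x. of_bool (qrun Q x \<noteq> first l' x) + \<gamma> * qcost Q x) z \<le> 2 * \<kappa>"
    proof -
      have "avg p U (\<lambda>x. of_bool (qrun Q x \<noteq> first l' x) + \<gamma> * qcost Q x) z \<le>
         avg p U (\<lambda>x. of_bool (hits l' x \<noteq> 0) * (1/2) ^ N + \<gamma> * N + hits l' x * \<kappa>) z"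
        using Q(2) by simp
      also have "\<dots> \<le> avg p U (\<lambda>x. \<kappa> + \<kappa> * real (hits l x)) z"
      proof (rule avg_mono[OF U(1)])
        fix x
        have "of_bool (hits l' x \<noteq> 0) * (1/2) ^ N + \<gamma> * N \<le> \<kappa>"
          using \<gamma> by (simp add: \<kappa>_def of_bool_def distrib_left)
        moreover have "real (hits l' x) * \<kappa> \<le> real (hits l x) * \<kappa>"
          using hits_take_le[of m l x] \<kappa> by (intro mult_right_mono) (auto simp: l'_def)
        ultimately show "of_bool (hits l' x \<noteq> 0) * (1/2) ^ N + \<gamma> * N + hits l' x * \<kappa> \<le> \<kappa> + \<kappa> * real (hits l x)"
          by (simp add: mult.commute)
      qed
      also have "\<dots> = \<kappa> + \<kappa> * avg p U (\<lambda>x. real (hits l x)) z"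
        by (simp add: avg_add[OF U(1)])
      also have "\<dots> \<le> 2 * \<kappa>"
        using mult_left_mono[OF hits \<kappa>] by simp
      finally show ?thesis .
    qed
    define S where "S = graft Q C"
    \<comment> \<open>If \<open>Q\<close> errs, the cap bounds the loss by 1, which is charged to
      the search. Otherwise the right continuation is run.\<close>
    have "avg p U (cap_loss \<gamma> L S) z \<le>
        avg p U (\<lambda>x. cap_loss \<gamma> L (C (first l' x)) x + (of_bool (qrun Q x \<noteq> first l' x) + \<gamma> * qcost Q x)) z"
    proof (rule avg_mono[OF U(1)])
      fix x
      have "0 \<le> \<gamma> * qcost Q x"
        using \<gamma> by simp
      moreover have "0 \<le> cap_loss \<gamma> L (C (first l' x)) x"
        using less.prems(5) \<gamma> by (simp add: cap_loss_def is_loss_def)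
      ultimately show "cap_loss \<gamma> L S x \<le>
          cap_loss \<gamma> L (C (first l' x)) x + (of_bool (qrun Q x \<noteq> first l' x) + \<gamma> * qcost Q x)"
        by (cases "qrun Q x = first l' x") (auto simp: cap_loss_def S_def distrib_left min_def)
    qed
    also have "\<dots> \<le> mix p U l (\<lambda>s. cap_loss \<gamma> L (C s)) z + 2 * \<kappa>"
      using m search unfolding l'_def[symmetric] by (simp add: avg_add[OF U(1)])
    also note 2(7)
    finally have S: "avg p U (cap_loss \<gamma> L S) z \<le> avg p U (\<lambda>x. L x (qrun T x)) z + \<gamma> + \<theta> +
        (real (card U) - 1) * \<delta> + \<Gamma> * (pivots p U T z - (1 - miss p l)) + 2 * \<kappa>"
      by simp
    \<comment> \<open>The two summands \<open>(1/2) ^ N\<close> in \<open>2 * \<kappa>\<close> make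
      up \<open>\<delta>\<close>; the remaining \<open>\<gamma> * (2 * (N + e) + 1)\<close> is paid
      for by the pivot of the batch.\<close>
    have "\<gamma> + 2 * \<kappa> \<le> \<delta> + \<Gamma> * (1 - miss p l)"
    proof -
      have "miss p l * (1 + \<theta>) \<le> miss p l * (1 + (\<Sum>i\<leftarrow>l. 2 * p i))"
        using 2(6) miss_bound(1)[OF p] by (intro mult_left_mono) auto
      also note miss_bound(2)[OF p]
      finally have "\<theta> \<le> (1 - miss p l) * (1 + \<theta>)"
        by (simp add: algebra_simps)
      then have "\<Gamma> * \<theta> \<le> \<Gamma> * ((1 - miss p l) * (1 + \<theta>))"
        using \<Gamma>(1) by (rule mult_left_mono)
      with \<Gamma>(2) have "\<gamma> * (2 * (real N + real e) + 1) * (1 + \<theta>) \<le> (\<Gamma> * (1 - miss p l)) * (1 + \<theta>)"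
        by (simp only: mult.assoc) 
      then have "\<gamma> * (2 * (real N + real e) + 1) \<le> \<Gamma> * (1 - miss p l)"
        using \<theta>(1) by simp
      then show ?thesis
        by (simp add: \<kappa>_def \<delta>_def algebra_simps)
    qed
    with S have "avg p U (cap_loss \<gamma> L S) z \<le>
        avg p U (\<lambda>x. L x (qrun T x)) z + \<theta> + card U * \<delta> + \<Gamma> * pivots p U T z"
      by (simp add: algebra_simps)
    moreover have "over V S"
      unfolding S_def by (rule over_graft[OF over_mono[OF Q(1) U(2)]]) (simp add: 2(4))
    ultimately show "\<exists>S. simulates p \<gamma> \<Gamma> \<theta> \<delta> U V T L z S"
      by (intro exI[of _ S]) (simp add: simulates_def)
  qed
qed

section \<open>Summation over the blocks\<close>

lemma qrun_map [simp]: "qrun (map_qtree g T) x = g (qrun T x)"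
  by (induction T) auto

lemma qcost_map [simp]: "qcost (map_qtree g T) x = qcost T x"
  by (induction T) auto

lemma over_map: "over U T \<Longrightarrow> over U (map_qtree g T)"
  by (induction T) auto

lemma avg_override: "avg p U \<phi> z = avg p U (\<lambda>x. \<phi> (\<lambda>i. if i \<in> U then x i else z i)) z'"
proof -
  have "(\<lambda>i. if i \<in> U then (if i \<in> U then x i else z' i) else z i) = (\<lambda>i. if i \<in> U then x i else z i)"
    for x :: "nat \<Rightarrow> bool"
    by (rule ext) simp
  then show ?thesis
    unfolding avg_def by (simp only:)
qed

text \<open>Induction on the number of blocks. For every fixing of the other blocks, simulating the
  tree on the last one bounds \<open>v\<close> by the error there plus \<open>\<Gamma>\<close> times
  the pivots. Eliminating the last block saves as many queries on average, so the pivots cancel and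
  the errors of the blocks add up.\<close>

lemma direct_sum:
  fixes F :: "nat \<Rightarrow> (nat \<Rightarrow> bool) \<Rightarrow> bool" and \<gamma> \<Gamma> \<theta> v :: real
  assumes p: "biases p" "\<And>i. p i \<le> 1/2" and \<gamma>: "0 \<le> \<gamma>" and \<theta>: "0 < \<theta>" "\<theta> \<le> 1"
    and \<Gamma>: "0 \<le> \<Gamma>" "\<gamma> * (2 * (real N + real e) + 1) * (1 + \<theta>) \<le> \<Gamma> * \<theta>"
    and n: "n \<le> 2 ^ e"
    and F: "\<And>j x y. (\<And>i. i \<in> {j * n..<Suc j * n} \<Longrightarrow> x i = y i) \<Longrightarrow> F j x = F j y"
    and v: "\<And>j S. j < k \<Longrightarrow> over {j * n..<Suc j * n} S \<Longrightarrow>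
      v \<le> avg p {j * n..<Suc j * n} (cap_loss \<gamma> (\<lambda>x y. of_bool (y \<noteq> F j x)) S) (\<lambda>_. False)"
    and m: "m \<le> k" and T: "over {..<m * n} T"
  shows "m * v \<le> avg p {..<m * n} (\<lambda>x. (\<Sum>j<m. of_bool (qrun T x j \<noteq> F j x)) + \<Gamma> * qcost T x) (\<lambda>_. False) +
    m * (\<theta> + n * (2 * (1/2) ^ N))"
  using m T
proof (induction m arbitrary: T)
  case 0
  then show ?case
    using \<Gamma>(1) by simp
next
  case (Suc m)
  define U where "U = {m * n..<Suc m * n}"
  define Z where "Z = {..<m * n}"
  let ?o = "\<lambda>_. False"
  have fin: "finite U" "finite Z" and UZ: "U \<inter> Z = {}" and un: "U \<union> Z = {..<Suc m * n}"
    by (auto simp: U_def Z_def)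
  have cU: "card U = n"
    by (simp add: U_def)
  have T: "over (U \<union> Z) T"
    using Suc.prems(2) by (simp only: un)
  define L where "L x y = (of_bool (y m \<noteq> F m x) :: real)" for x and y :: "nat \<Rightarrow> bool"
  define M where "M x y = (\<Sum>j<m. of_bool (y j \<noteq> F j x) :: real)" for x and y :: "nat \<Rightarrow> bool"
  define \<epsilon> where "\<epsilon> = \<theta> + n * (2 * (1/2) ^ N)"
  have vz: "v \<le> avg p U (\<lambda>x. L x (qrun T x)) z + \<epsilon> + \<Gamma> * pivots p U T z" for z
  proof -
    have "is_loss L"
      by (simp add: is_loss_def L_def)
    then obtain S where "simulates p \<gamma> \<Gamma> \<theta> (2 * (1/2) ^ N) U (U \<union> Z) T L z S"
      using single_block[OF p \<gamma> \<theta> \<Gamma> fin(1) Un_upper1 _ T, of L z] n cU by auto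
    then have S: "over (U \<union> Z) S"
      "avg p U (cap_loss \<gamma> L S) z \<le> avg p U (\<lambda>x. L x (qrun T x)) z + \<epsilon> + \<Gamma> * pivots p U T z"
      using cU by (auto simp: \<epsilon>_def simulates_def)
    \<comment> \<open>Fixing the other blocks to \<open>z\<close> turns \<open>S\<close> into a tree
      on the last block alone. Only bit \<open>m\<close> of its output is kept.\<close>
    define \<sigma> where "\<sigma> x = (\<lambda>i. if i \<in> U then x i else z i)" for x
    define S' where "S' = map_qtree (\<lambda>y. y m) (qsubst \<sigma> S)"
    have "aff U (\<lambda>x. \<sigma> x i)" for i
      by (cases "i \<in> U") (auto simp: \<sigma>_def intro: aff.intros)
    then have "over U S'"
      unfolding S'_def by (intro over_map over_subst[OF S(1)])
    then have "v \<le> avg p U (cap_loss \<gamma> (\<lambda>x y. of_bool (y \<noteq> F m x)) S') ?o"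
      using v[of m S'] Suc.prems(1) by (simp add: U_def)
    also have "cap_loss \<gamma> (\<lambda>x y. of_bool (y \<noteq> F m x)) S' = (\<lambda>x. cap_loss \<gamma> L S (\<sigma> x))"
    proof
      fix x
      have "F m (\<sigma> x) = F m x"
        by (rule F) (simp add: \<sigma>_def U_def)
      then show "cap_loss \<gamma> (\<lambda>x y. of_bool (y \<noteq> F m x)) S' x = cap_loss \<gamma> L S (\<sigma> x)"
        by (simp add: cap_loss_def S'_def L_def)
    qed
    also have "avg p U (\<lambda>x. cap_loss \<gamma> L S (\<sigma> x)) ?o = avg p U (cap_loss \<gamma> L S) z"
      unfolding \<sigma>_def by (rule avg_override[symmetric])
    also note S(2)
    finally show ?thesis .
  qed
  have M: "M (x(i := b)) y = M x y" if i: "i \<in> U" for x y i b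
  proof -
    have "F j (x(i := b)) = F j x" if "j < m" for j
    proof (rule F)
      fix i' assume "i' \<in> {j * n..<Suc j * n}"
      moreover have "Suc j * n \<le> m * n"
        using that by (intro mult_right_mono) auto
      ultimately have "i' < m * n"
        by simp
      then show "(x(i := b)) i' = x i'"
        using i by (auto simp: U_def)
    qed
    then show ?thesis
      by (simp add: M_def)
  qed
  have "\<exists>T'. over Z T' \<and>
    avg p Z (\<lambda>z. 1 * (M z (qrun T' z) + \<Gamma> * qcost T' z)) ?o \<le>
    avg p Z (\<lambda>z. 1 * (avg p U (\<lambda>x. M x (qrun T x) + \<Gamma> * qcost T x) z - \<Gamma> * pivots p U T z)) ?o"
    by (rule eliminate_block[OF fin UZ p T]) (rule zero_le_one, rule M, assumption, simp)
  then obtain T' where T': "over Z T'"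
    "avg p Z (\<lambda>z. M z (qrun T' z) + \<Gamma> * qcost T' z) ?o \<le>
     avg p Z (\<lambda>z. avg p U (\<lambda>x. M x (qrun T x) + \<Gamma> * qcost T x) z - \<Gamma> * pivots p U T z) ?o"
    by auto
  have "real (Suc m) * v = m * v + avg p Z (\<lambda>z. v) ?o"
    by (simp add: distrib_right)
  also have "m * v \<le> avg p Z (\<lambda>x. M x (qrun T' x) + \<Gamma> * qcost T' x) ?o + m * \<epsilon>"
    using Suc.IH[of T'] Suc.prems(1) T'(1) by (simp add: M_def Z_def \<epsilon>_def)
  also note T'(2)
  also have "avg p Z (\<lambda>z. v) ?o \<le>
      avg p Z (\<lambda>z. avg p U (\<lambda>x. L x (qrun T x)) z + \<epsilon> + \<Gamma> * pivots p U T z) ?o"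
    using vz by (intro avg_mono fin)
  \<comment> \<open>Here the pivots saved by the elimination cancel those spent on the
    simulation.\<close>
  also have "avg p Z (\<lambda>z. avg p U (\<lambda>x. M x (qrun T x) + \<Gamma> * qcost T x) z - \<Gamma> * pivots p U T z) ?o + m * \<epsilon> +
      avg p Z (\<lambda>z. avg p U (\<lambda>x. L x (qrun T x)) z + \<epsilon> + \<Gamma> * pivots p U T z) ?o =
      avg p Z (\<lambda>z. avg p U (\<lambda>x. M x (qrun T x) + \<Gamma> * qcost T x) z + avg p U (\<lambda>x. L x (qrun T x)) z) ?o +
      Suc m * \<epsilon>"
    by (simp add: avg_add[OF fin(2)] avg_diff[OF fin(2)] algebra_simps)
  also have "avg p Z (\<lambda>z. avg p U (\<lambda>x. M x (qrun T x) + \<Gamma> * qcost T x) z + avg p U (\<lambda>x. L x (qrun T x)) z) ?o =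
      avg p (U \<union> Z) (\<lambda>x. (M x (qrun T x) + \<Gamma> * qcost T x) + L x (qrun T x)) ?o"
    unfolding avg_union[OF fin UZ p(1)]
    by (rule arg_cong[where f = "\<lambda>\<phi>. avg p Z \<phi> ?o"]) (rule ext, rule avg_add[OF fin(1), symmetric])
  also have "(\<lambda>x. (M x (qrun T x) + \<Gamma> * qcost T x) + L x (qrun T x)) =
      (\<lambda>x. (\<Sum>j<Suc m. of_bool (qrun T x j \<noteq> F j x)) + \<Gamma> * qcost T x)"
    by (simp add: M_def L_def algebra_simps)
  finally show ?case
    unfolding un \<epsilon>_def by simp
qed

section \<open>Parity decision trees\<close>

lemma avg_bias_cong: "(\<And>i. i \<in> U \<Longrightarrow> p i = q i) \<Longrightarrow> avg p U \<phi> z = avg q U \<phi> z"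
  unfolding avg_def by (auto intro!: arg_cong2[where f = measure_pmf.expectation] Pi_pmf_cong)

definition shift :: "nat \<Rightarrow> (nat \<Rightarrow> bool) \<Rightarrow> nat \<Rightarrow> bool" where
  "shift s x i \<longleftrightarrow> s \<le> i \<and> x (i - s)"

lemma avg_shift:
  assumes "finite U" "biases p"
  shows "avg p ((+) s ` U) \<phi> (shift s z) = avg (\<lambda>i. p (s + i)) U (\<lambda>x. \<phi> (shift s x)) z"
  using assms(1)
proof (induction U arbitrary: z rule: finite_induct)
  case (insert i U)
  have *: "(shift s z)(s + i := b) = shift s (z(i := b))" for b
    by (rule ext) (auto simp: shift_def)
  have pi: "0 \<le> p j" "p j \<le> 1" for j
    using assms(2) by (auto simp: biases_def)
  have "avg p ((+) s ` insert i U) \<phi> (shift s z) =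
      p (s + i) * avg p ((+) s ` U) \<phi> ((shift s z)(s + i := True)) +
      (1 - p (s + i)) * avg p ((+) s ` U) \<phi> ((shift s z)(s + i := False))"
    unfolding image_insert using insert.hyps pi by (intro avg_insert) auto
  also have "\<dots> = avg (\<lambda>i. p (s + i)) (insert i U) (\<lambda>x. \<phi> (shift s x)) z"
    unfolding * insert.IH using insert.hyps pi by (intro avg_insert[symmetric]) auto
  finally show ?case .
qed simp

section \<open>Inner products over F_2 and conversion of trees\<close>

lemma ip2_Suc: "ip2 (Suc N) a x \<longleftrightarrow> ip2 N a x \<noteq> (a N \<and> x N)"
  by (auto simp: ip2_def)

lemma ip2_False: "\<not> ip2 N (\<lambda>_. False) x"
  by (simp add: ip2_def)

lemma ip2_xor: "ip2 N (\<lambda>i. a i \<noteq> b i) x \<longleftrightarrow> ip2 N a x \<noteq> ip2 N b x"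
proof (induction N)
  case 0
  show ?case by (simp add: ip2_def)
next
  case (Suc N)
  then show ?case
    unfolding ip2_Suc by argo
qed

lemma aff_ip2: "aff {..<N} (ip2 N a)"
proof (induction N)
  case 0
  have "ip2 0 a = (\<lambda>_. False)"
    by (rule ext) (simp add: ip2_def)
  then show ?case
    by (simp add: aff_const)
next
  case (Suc N)
  have "aff {..<Suc N} (\<lambda>x. a N \<and> x N)"
    by (cases "a N") (simp_all add: aff_coord aff_const)
  from aff_xor[OF aff_mono[OF Suc, of "{..<Suc N}"] this]
  have "aff {..<Suc N} (\<lambda>x. ip2 N a x \<noteq> (a N \<and> x N))"
    by simp
  moreover have "ip2 (Suc N) a = (\<lambda>x. ip2 N a x \<noteq> (a N \<and> x N))"
    by (rule ext) (rule ip2_Suc)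
  ultimately show ?case
    by (simp only:)
qed

lemma aff_ip2_ex:
  assumes "aff {..<N} h"
  shows "\<exists>a c. a \<in> cube N \<and> (\<forall>x. h x \<longleftrightarrow> ip2 N a x \<noteq> c)"
  using assms
proof induction
  case (aff_const c)
  show ?case
    by (rule exI[of _ "\<lambda>_. False"], rule exI[of _ c]) (simp add: cube_def ip2_False)
next
  case (aff_coord i)
  then show ?case
    by (intro exI[of _ "\<lambda>j. j = i"] exI[of _ False]) (auto simp: cube_def ip2_unit)
next
  case (aff_xor g h)
  then obtain a b c d where ab: "a \<in> cube N" "b \<in> cube N"
    and g: "\<And>x. g x \<longleftrightarrow> ip2 N a x \<noteq> c" and h: "\<And>x. h x \<longleftrightarrow> ip2 N b x \<noteq> d"
    by blast
  have "(g x \<noteq> h x) = (ip2 N (\<lambda>i. a i \<noteq> b i) x \<noteq> (c \<noteq> d))" for x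
    unfolding ip2_xor g h by argo
  moreover have "(\<lambda>i. a i \<noteq> b i) \<in> cube N"
    using ab by (auto simp: cube_def)
  ultimately show ?case
    by blast
qed

primrec qtree_of_pdt :: "nat \<Rightarrow> 'o pdt \<Rightarrow> 'o qtree" where
  "qtree_of_pdt N (Leaf y) = QLeaf y"
| "qtree_of_pdt N (Query a T0 T1) = QNode (ip2 N a) (qtree_of_pdt N T0) (qtree_of_pdt N T1)"

lemma qrun_of_pdt [simp]: "qrun (qtree_of_pdt N T) x = run N T x"
  by (induction T) auto

lemma qcost_of_pdt: "qcost (qtree_of_pdt N T) x \<le> depth T"
  by (induction T) (auto simp: le_max_iff_disj)

lemma over_of_pdt: "over {..<N} (qtree_of_pdt N T)"
  by (induction T) (auto simp: aff_ip2)

text \<open>Truncation at depth \<open>M\<close>: inputs that need more queries get an arbitrary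
  output. The constant term of an affine query is absorbed by exchanging the subtrees.\<close>

lemma pdt_of_qtree:
  assumes "over {..<N} S"
  shows "\<exists>T. is_pdt N UNIV T \<and> depth T \<le> M \<and> (\<forall>x. qcost S x \<le> M \<longrightarrow> run N T x = qrun S x)"
  using assms
proof (induction S arbitrary: M)
  case (QLeaf y)
  show ?case
    by (rule exI[of _ "Leaf y"]) simp
next
  case (QNode h S0 S1)
  show ?case
  proof (cases M)
    case 0
    then show ?thesis
      by (intro exI[of _ "Leaf undefined"]) simp
  next
    case (Suc M')
    obtain T0 where T0: "is_pdt N UNIV T0" "depth T0 \<le> M'" "\<forall>x. qcost S0 x \<le> M' \<longrightarrow> run N T0 x = qrun S0 x"
      using QNode.IH(1)[of M'] QNode.prems by auto
    obtain T1 where T1: "is_pdt N UNIV T1" "depth T1 \<le> M'" "\<forall>x. qcost S1 x \<le> M' \<longrightarrow> run N T1 x = qrun S1 x"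
      using QNode.IH(2)[of M'] QNode.prems by auto
    obtain a c where a: "a \<in> cube N" "\<And>x. h x \<longleftrightarrow> ip2 N a x \<noteq> c"
      using aff_ip2_ex[of N h] QNode.prems by auto
    show ?thesis
      using T0 T1 a Suc
      by (intro exI[of _ "Query a (if c then T1 else T0) (if c then T0 else T1)"]) auto
  qed
qed

section \<open>Reduction of the error by a majority vote\<close>

text \<open>The average is affine in the indicator of \<open>B\<close>, so for a random tree the
  indicator turns into its probability. Some tree in the support does not exceed this expectation.
  \<open>c\<close> and \<open>r\<close> will hold the contributions of the other two runs.\<close>

lemma pick_tree:
  fixes c r :: "nat \<Rightarrow> (nat \<Rightarrow> bool) \<Rightarrow> real"
  assumes "finite U" "biases p" "\<And>j x. \<bar>c j x\<bar> \<le> 1" "\<And>j x. \<bar>r j x\<bar> \<le> 1"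
  shows "\<exists>t\<in>set_pmf \<T>. avg p U (\<lambda>x. \<Sum>j<k. of_bool (B j x t) * c j x + r j x) z \<le>
    avg p U (\<lambda>x. \<Sum>j<k. measure_pmf.prob \<T> {t. B j x t} * c j x + r j x) z"
proof (rule ccontr)
  define \<psi> where "\<psi> x t = (\<Sum>j<k. of_bool (B j x t) * c j x + r j x)" for x t
  define a where "a = avg p U (\<lambda>x. \<Sum>j<k. measure_pmf.prob \<T> {t. B j x t} * c j x + r j x) z"
  assume "\<not> ?thesis"
  then have gt: "a < avg p U (\<lambda>x. \<psi> x t) z" if "t \<in> set_pmf \<T>" for t
    using that by (auto simp: a_def \<psi>_def not_le)
  have bd: "\<bar>\<psi> x t\<bar> \<le> 2 * real k" for x t
  proof -
    have "\<bar>of_bool (B j x t) * c j x + r j x\<bar> \<le> 2" for j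
      using assms(3)[of j x] assms(4)[of j x] by (auto simp: abs_le_iff)
    then have "\<bar>\<psi> x t\<bar> \<le> (\<Sum>j<k. 2)"
      unfolding \<psi>_def by (intro order_trans[OF sum_abs] sum_mono) auto
    then show ?thesis by simp
  qed
  have "\<bar>avg p U (\<lambda>x. \<psi> x t) z\<bar> \<le> 2 * real k" for t
    using avg_mono[OF assms(1), of z "\<lambda>_. - (2 * real k)" "\<lambda>x. \<psi> x t" p]
      avg_mono[OF assms(1), of z "\<lambda>x. \<psi> x t" "\<lambda>_. 2 * real k" p] bd[of _ t]
    by (auto simp: abs_le_iff minus_le_iff)
  then have "integrable (measure_pmf \<T>) (\<lambda>t. avg p U (\<lambda>x. \<psi> x t) z)"
    by (intro measure_pmf.integrable_const_bound[of _ "2 * real k"]) auto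
  then have "a < measure_pmf.expectation \<T> (\<lambda>t. avg p U (\<lambda>x. \<psi> x t) z)"
    using gt by (intro measure_pmf.expectation_greater) (auto simp: AE_measure_pmf_iff)
  also have "\<dots> = avg p U (\<lambda>x. measure_pmf.expectation \<T> (\<psi> x)) z"
    using bd by (rule avg_swap_expectation[OF assms(1,2)])
  also have "(\<lambda>x. measure_pmf.expectation \<T> (\<psi> x)) =
      (\<lambda>x. \<Sum>j<k. measure_pmf.prob \<T> {t. B j x t} * c j x + r j x)"
  proof
    fix x
    have *: "integrable (measure_pmf \<T>) (\<lambda>t. of_bool (B j x t) :: real)" for j
      by (intro measure_pmf.integrable_const_bound[of _ 1]) auto
    have "(\<lambda>t. of_bool (B j x t) :: real) = indicator {t. B j x t}" for j
      by (auto simp: indicator_def)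
    then have "measure_pmf.expectation \<T> (\<lambda>t. of_bool (B j x t) :: real) = measure_pmf.prob \<T> {t. B j x t}" for j
      by simp
    then show "measure_pmf.expectation \<T> (\<psi> x) = (\<Sum>j<k. measure_pmf.prob \<T> {t. B j x t} * c j x + r j x)"
      unfolding \<psi>_def using * by (subst Bochner_Integration.integral_sum) auto
  qed
  finally show False
    by (simp add: a_def)
qed

definition maj :: "bool \<Rightarrow> bool \<Rightarrow> bool \<Rightarrow> bool" where
  "maj a b c \<longleftrightarrow> (a \<and> b) \<or> (b \<and> c) \<or> (a \<and> c)"

text \<open>
  The probability that at least two of three independent events of probabilities \<open>a\<close>, \<open>b\<close>, \<open>c\<close>
  occur. It is affine in each argument, so the three trees can be fixed one after the other.
\<close>

definition two3 :: "real \<Rightarrow> real \<Rightarrow> real \<Rightarrow> real" where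
  "two3 a b c = a * (b + c - 2 * b * c) + b * c"

lemma two3_commute: "two3 a b c = two3 b a c" "two3 a b c = two3 c b a"
  by (simp_all add: two3_def algebra_simps)

lemma two3_coeff:
  fixes b c :: real
  assumes "0 \<le> b" "b \<le> 1" "0 \<le> c" "c \<le> 1"
  shows "\<bar>b + c - 2 * b * c\<bar> \<le> 1" "\<bar>b * c\<bar> \<le> 1"
proof -
  have "0 \<le> b * (1 - c)" "0 \<le> c * (1 - b)" "0 \<le> (1 - b) * (1 - c)" "0 \<le> b * c" "b * c \<le> 1"
    using assms by (auto intro: mult_nonneg_nonneg mult_le_one)
  then show "\<bar>b + c - 2 * b * c\<bar> \<le> 1" "\<bar>b * c\<bar> \<le> 1"
    by (auto simp: algebra_simps abs_le_iff)
qed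

text \<open>\<open>two3 q q q\<close> is 3 q^2 - 2 q^3, the error of a majority vote of three runs
  with error \<open>q\<close>. It equals 7/27 at q = 1/3.\<close>

lemma two3_third:
  fixes q :: real
  assumes "0 \<le> q" "q \<le> 1/3"
  shows "two3 q q q \<le> 7/27"
proof -
  have "q * q \<le> q * (1/3)" "0 \<le> q * q"
    using assms by (intro mult_left_mono) auto
  \<comment> \<open>The cubic vanishes at 1/3, and the other factor is nonnegative because
    \<open>q * q\<close> is at most q / 3.\<close>
  moreover have "7/27 - two3 q q q = (1/3 - q) * (7/9 + (7/3) * q - 2 * (q * q))"
    by (simp add: two3_def field_simps)
  moreover have "0 \<le> 7/9 + (7/3) * q - 2 * (q * q)"
    using calculation(1,2) assms by linarith
  ultimately show ?thesis
    using assms by (metis diff_ge_0_iff_ge mult_nonneg_nonneg)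
qed

text \<open>Each use of \<open>pick\<close> replaces one probability by the indicator of a fixed
  tree without raising the average. The symmetry of \<open>two3\<close> brings the next probability
  to the first place.\<close>

lemma majority_of_three:
  fixes \<T> :: "'t pmf" and B :: "nat \<Rightarrow> (nat \<Rightarrow> bool) \<Rightarrow> 't \<Rightarrow> bool"
  assumes U: "finite U" and p: "biases p"
    and B: "\<And>j x. j < k \<Longrightarrow> (\<And>i. i \<notin> U \<Longrightarrow> x i = z i) \<Longrightarrow> measure_pmf.prob \<T> {t. B j x t} \<le> 1/3"
  shows "\<exists>t1\<in>set_pmf \<T>. \<exists>t2\<in>set_pmf \<T>. \<exists>t3\<in>set_pmf \<T>.
    avg p U (\<lambda>x. \<Sum>j<k. of_bool (maj (B j x t1) (B j x t2) (B j x t3))) z \<le> 7/27 * k"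
proof -
  define q where "q j x = measure_pmf.prob \<T> {t. B j x t}" for j x
  define e where "e t j x = (of_bool (B j x t) :: real)" for t j x
  have q: "0 \<le> q j x" "q j x \<le> 1" for j x
    by (auto simp: q_def)
  have e: "0 \<le> e t j x" "e t j x \<le> 1" for t j x
    by (auto simp: e_def)
  have pick: "\<exists>t\<in>set_pmf \<T>. avg p U (\<lambda>x. \<Sum>j<k. two3 (e t j x) (b j x) (c j x)) z \<le>
      avg p U (\<lambda>x. \<Sum>j<k. two3 (q j x) (b j x) (c j x)) z"
    if "\<And>j x. 0 \<le> b j x" "\<And>j x. b j x \<le> 1" "\<And>j x. 0 \<le> c j x" "\<And>j x. c j x \<le> 1" for b c
    unfolding two3_def e_def q_def using that
    by (intro pick_tree[OF U p] two3_coeff)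
  obtain t1 where t1: "t1 \<in> set_pmf \<T>" "avg p U (\<lambda>x. \<Sum>j<k. two3 (e t1 j x) (q j x) (q j x)) z \<le>
      avg p U (\<lambda>x. \<Sum>j<k. two3 (q j x) (q j x) (q j x)) z"
    using pick[of q q] q by blast
  obtain t2 where t2: "t2 \<in> set_pmf \<T>" "avg p U (\<lambda>x. \<Sum>j<k. two3 (e t2 j x) (e t1 j x) (q j x)) z \<le>
      avg p U (\<lambda>x. \<Sum>j<k. two3 (q j x) (e t1 j x) (q j x)) z"
    using pick[of "e t1" q] q e by blast
  obtain t3 where t3: "t3 \<in> set_pmf \<T>" "avg p U (\<lambda>x. \<Sum>j<k. two3 (e t3 j x) (e t1 j x) (e t2 j x)) z \<le>
      avg p U (\<lambda>x. \<Sum>j<k. two3 (q j x) (e t1 j x) (e t2 j x)) z"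
    using pick[of "e t1" "e t2"] e by blast
  have "(\<lambda>x. \<Sum>j<k. of_bool (maj (B j x t1) (B j x t2) (B j x t3))) =
      (\<lambda>x. \<Sum>j<k. two3 (e t3 j x) (e t1 j x) (e t2 j x))"
    by (intro ext sum.cong refl) (auto simp: maj_def two3_def e_def)
  then have "avg p U (\<lambda>x. \<Sum>j<k. of_bool (maj (B j x t1) (B j x t2) (B j x t3))) z =
      avg p U (\<lambda>x. \<Sum>j<k. two3 (e t3 j x) (e t1 j x) (e t2 j x)) z"
    by (simp only:)
  also note t3(2)
  also have "(\<lambda>x. \<Sum>j<k. two3 (q j x) (e t1 j x) (e t2 j x)) = (\<lambda>x. \<Sum>j<k. two3 (e t2 j x) (e t1 j x) (q j x))"
    by (intro ext sum.cong refl) (rule two3_commute(2))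
  also note t2(2)
  also have "(\<lambda>x. \<Sum>j<k. two3 (q j x) (e t1 j x) (q j x)) = (\<lambda>x. \<Sum>j<k. two3 (e t1 j x) (q j x) (q j x))"
    by (intro ext sum.cong refl) (rule two3_commute(1))
  also note t1(2)
  also have "avg p U (\<lambda>x. \<Sum>j<k. two3 (q j x) (q j x) (q j x)) z \<le> avg p U (\<lambda>_. \<Sum>j<k. 7/27) z"
  proof (rule avg_mono[OF U])
    fix x assume "\<And>i. i \<notin> U \<Longrightarrow> x i = z i"
    then have "q j x \<le> 1/3" if "j < k" for j
      unfolding q_def using that by (intro B)
    then show "(\<Sum>j<k. two3 (q j x) (q j x) (q j x)) \<le> (\<Sum>j<k. 7/27)"
      using q by (intro sum_mono two3_third) auto
  qed
  finally show ?thesis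
    using t1(1) t2(1) t3(1) by (auto simp: mult.commute)
qed

section \<open>Transfer to the distributional complexity\<close>

lemma prob_eq_avg:
  "measure_pmf.prob (Pi_pmf {..<n} False (\<lambda>i. bernoulli_pmf (p i))) {x. P x} =
    avg p {..<n} (\<lambda>x. of_bool (P x)) (\<lambda>_. False)"
proof -
  let ?\<mu> = "Pi_pmf {..<n} False (\<lambda>i. bernoulli_pmf (p i))"
  have "measure_pmf.prob ?\<mu> {x. P x} = measure_pmf.expectation ?\<mu> (indicator {x. P x})"
    by simp
  also have "\<dots> = avg p {..<n} (\<lambda>x. of_bool (P x)) (\<lambda>_. False)"
    unfolding avg_def
  proof (rule integral_cong_AE)
    have "indicator {x. P x} x = (of_bool (P (\<lambda>i. if i \<in> {..<n} then x i else False)) :: real)"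
      if "x \<in> set_pmf ?\<mu>" for x
    proof -
      have "\<And>i. i \<notin> {..<n} \<Longrightarrow> x i = False"
        using set_Pi_pmf_subset[of "{..<n}" False "\<lambda>i. bernoulli_pmf (p i)"] that by auto
      then have "(\<lambda>i. if i \<in> {..<n} then x i else False) = x"
        by (intro ext) metis
      then show ?thesis
        by (simp add: indicator_def)
    qed
    then show "AE x in measure_pmf ?\<mu>. indicator {x. P x} x =
        (of_bool (P (\<lambda>i. if i \<in> {..<n} then x i else False)) :: real)"
      by (simp add: AE_measure_pmf_iff)
  qed auto
  finally show ?thesis .
qed

text \<open>The tree is cut off after floor (1 / \<gamma>) queries. An input that needs more has
  capped loss 1 and already counts as an error.\<close>

lemma D_pdt_le:
  assumes "biases p" "0 < \<gamma>" "over {..<n} S"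
    and "avg p {..<n} (cap_loss \<gamma> (\<lambda>x y. of_bool (y \<noteq> f x)) S) (\<lambda>_. False) \<le> \<epsilon>"
  shows "real (D_pdt \<epsilon> n f (Pi_pmf {..<n} False (\<lambda>i. bernoulli_pmf (p i)))) \<le> 1 / \<gamma>"
proof -
  define M where "M = nat \<lfloor>1 / \<gamma>\<rfloor>"
  obtain T where T: "is_pdt n UNIV T" "depth T \<le> M" "\<And>x. qcost S x \<le> M \<Longrightarrow> run n T x = qrun S x"
    using pdt_of_qtree[OF assms(3), of M] by blast
  have "measure_pmf.prob (Pi_pmf {..<n} False (\<lambda>i. bernoulli_pmf (p i))) {x. run n T x \<noteq> f x} =
      avg p {..<n} (\<lambda>x. of_bool (run n T x \<noteq> f x)) (\<lambda>_. False)"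
    by (rule prob_eq_avg)
  also have "\<dots> \<le> avg p {..<n} (cap_loss \<gamma> (\<lambda>x y. of_bool (y \<noteq> f x)) S) (\<lambda>_. False)"
  proof (rule avg_mono)
    fix x
    show "of_bool (run n T x \<noteq> f x) \<le> cap_loss \<gamma> (\<lambda>x y. of_bool (y \<noteq> f x)) S x"
    proof (cases "qcost S x \<le> M")
      case True
      then show ?thesis
        using T(3)[OF True] assms(2) by (simp add: cap_loss_def)
    next
      case False
      then have "1 / \<gamma> < real (qcost S x)"
        unfolding M_def using assms(2) by (simp add: not_le nat_less_iff floor_less_iff)
      then have "1 \<le> \<gamma> * qcost S x"
        using assms(2) by (simp add: field_simps)
      then show ?thesis
        by (simp add: cap_loss_def)
    qed
  qed simp
  also note assms(4)
  finally have "D_pdt \<epsilon> n f (Pi_pmf {..<n} False (\<lambda>i. bernoulli_pmf (p i))) \<le> depth T"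
    unfolding D_pdt_def using T(1) by (intro Least_le) blast
  then have "D_pdt \<epsilon> n f (Pi_pmf {..<n} False (\<lambda>i. bernoulli_pmf (p i))) \<le> M"
    using T(2) by simp
  moreover have "real M \<le> 1 / \<gamma>"
    using assms(2) by (simp add: M_def)
  ultimately show ?thesis
    by linarith
qed

text \<open>The map \<open>\<sigma>\<close> moves an input of \<open>f\<close> to block
  \<open>j\<close> and flips the bits of bias above 1/2. It is affine, so a tree on the block
  becomes a tree for \<open>f\<close> under the original biases.\<close>

lemma block_complexity:
  fixes p :: "nat \<Rightarrow> real" and n k j :: nat and f :: "(nat \<Rightarrow> bool) \<Rightarrow> bool"
  defines "m \<equiv> \<lambda>i. i < k * n \<and> p (i mod n) > 1/2"
    and "p' \<equiv> \<lambda>i. if i < k * n then min (p (i mod n)) (1 - p (i mod n)) else 0"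
  assumes p: "\<And>i. i < n \<Longrightarrow> 0 \<le> p i \<and> p i \<le> 1" and j: "j < k" and \<gamma>: "0 < \<gamma>"
    and S: "over {j * n..<Suc j * n} S"
    and le: "avg p' {j * n..<Suc j * n}
      (cap_loss \<gamma> (\<lambda>x y. of_bool (y \<noteq> f (block n j (\<lambda>i. x i \<noteq> m i)))) S) (\<lambda>_. False) \<le> \<epsilon>"
  shows "real (D_pdt \<epsilon> n f (Pi_pmf {..<n} False (\<lambda>i. bernoulli_pmf (p i)))) \<le> 1 / \<gamma>"
proof -
  define s where "s = j * n"
  define m' where "m' i \<longleftrightarrow> i < n \<and> p i > 1/2" for i
  \<comment> \<open>The values of \<open>p\<close> from \<open>n\<close> on are unrestricted;
    setting them to 0 makes \<open>biases\<close> hold.\<close>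
  define r where "r i = (if i < n then p i else 0)" for i
  define \<sigma> where "\<sigma> x = shift s (\<lambda>i. x i \<noteq> m' i)" for x
  let ?\<phi> = "cap_loss \<gamma> (\<lambda>x y. of_bool (y \<noteq> f (block n j (\<lambda>i. x i \<noteq> m i)))) S"
  let ?o = "\<lambda>_ :: nat. False"
  have lt: "s + i < k * n" if "i < n" for i
  proof -
    have "s + i < Suc j * n"
      using that by (simp add: s_def)
    also have "\<dots> \<le> k * n"
      using j by (intro mult_right_mono) auto
    finally show ?thesis .
  qed
  have md: "(s + i) mod n = i" if "i < n" for i
    using that by (simp add: s_def)
  have blk: "{j * n..<Suc j * n} = (+) s ` {..<n}"
    unfolding s_def image_add_atLeastLessThan[of _ 0, simplified, folded lessThan_atLeast0] lessThan_atLeast0 by simp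
  have r: "biases r"
    using p by (simp add: biases_def r_def)
  have p': "biases p'"
  proof -
    have "0 \<le> p (i mod n)" "p (i mod n) \<le> 1" if "i < k * n" for i
    proof -
      have "n > 0"
        using that by (cases n) auto
      then show "0 \<le> p (i mod n)" "p (i mod n) \<le> 1"
        using p[of "i mod n"] by auto
    qed
    then show ?thesis
      by (auto simp: biases_def p'_def min_def)
  qed
  have "avg p' {j * n..<Suc j * n} ?\<phi> ?o = avg p' ((+) s ` {..<n}) ?\<phi> (shift s ?o)"
    unfolding blk by (simp add: shift_def[abs_def])
  also have "\<dots> = avg (\<lambda>i. p' (s + i)) {..<n} (\<lambda>x. ?\<phi> (shift s x)) ?o"
    by (rule avg_shift) (simp_all add: p')
  also have "\<dots> = avg (\<lambda>i. if m' i then 1 - r i else r i) {..<n} (\<lambda>x. ?\<phi> (shift s x)) ?o"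
    by (rule avg_bias_cong) (auto simp: p'_def m'_def r_def lt md)
  also have "\<dots> = avg r {..<n} (\<lambda>x. ?\<phi> (shift s (\<lambda>i. x i \<noteq> m' i))) m'"
    using avg_flip[OF finite_lessThan r, where m = m' and z = m' and \<phi> = "\<lambda>x. ?\<phi> (shift s x)"] by simp
  also have "\<dots> = avg r {..<n} (\<lambda>x. ?\<phi> (\<sigma> x)) ?o"
    unfolding \<sigma>_def by (rule avg_base_cong) (simp add: m'_def)
  also have "\<dots> = avg r {..<n} (cap_loss \<gamma> (\<lambda>x y. of_bool (y \<noteq> f x)) (qsubst \<sigma> S)) ?o"
  proof (rule avg_cong)
    fix x assume x: "\<And>i. i \<notin> {..<n} \<Longrightarrow> x i = False"
    have "block n j (\<lambda>i. \<sigma> x i \<noteq> m i) = x"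
    proof
      fix i
      show "block n j (\<lambda>i. \<sigma> x i \<noteq> m i) i = x i"
      proof (cases "i < n")
        case True
        then have "m (s + i) = m' i"
          by (simp add: m_def m'_def lt md)
        then show ?thesis
          using True by (cases "m' i") (simp_all add: block_def \<sigma>_def shift_def s_def)
      next
        case False
        then show ?thesis
          using x[of i] by (simp add: block_def)
      qed
    qed
    then show "?\<phi> (\<sigma> x) = cap_loss \<gamma> (\<lambda>x y. of_bool (y \<noteq> f x)) (qsubst \<sigma> S) x"
      by (simp add: cap_loss_def)
  qed
  finally have "avg r {..<n} (cap_loss \<gamma> (\<lambda>x y. of_bool (y \<noteq> f x)) (qsubst \<sigma> S)) ?o \<le> \<epsilon>"
    using le by simp
  moreover have "over {..<n} (qsubst \<sigma> S)"
  proof (rule over_subst[OF S])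
    fix i assume i: "i \<in> {j * n..<Suc j * n}"
    then have "aff {..<n} (\<lambda>x. x (i - s) \<noteq> m' (i - s))"
      by (intro aff_xor aff_coord aff_const) (auto simp: s_def)
    then show "aff {..<n} (\<lambda>x. \<sigma> x i)"
      using i by (simp add: \<sigma>_def shift_def s_def)
  qed
  ultimately have "real (D_pdt \<epsilon> n f (Pi_pmf {..<n} False (\<lambda>i. bernoulli_pmf (r i)))) \<le> 1 / \<gamma>"
    by (intro D_pdt_le[OF r \<gamma>])
  also have "Pi_pmf {..<n} False (\<lambda>i. bernoulli_pmf (r i)) = Pi_pmf {..<n} False (\<lambda>i. bernoulli_pmf (p i))"
    by (rule Pi_pmf_cong) (auto simp: r_def)
  finally show ?thesis .
qed

text \<open>Otherwise every tree on a single block has capped loss at least 1/3. For the majority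
  tree \<open>direct_sum\<close> then bounds k / 3 by 7 k / 27, its average number of wrong bits,
  plus terms that \<open>small\<close> makes too small.\<close>

lemma D_pdt_direct_sum:
  fixes p :: "nat \<Rightarrow> real" and n k d :: nat and f :: "(nat \<Rightarrow> bool) \<Rightarrow> bool" and \<T> :: "(nat \<Rightarrow> bool) pdt pmf"
    and \<gamma> :: real
  assumes n: "2 \<le> n" and \<gamma>: "0 < \<gamma>" and p: "\<And>i. i < n \<Longrightarrow> 0 \<le> p i \<and> p i \<le> 1"
    and depth: "\<And>T. T \<in> set_pmf \<T> \<Longrightarrow> depth T \<le> d"
    and err: "\<And>x. x \<in> cube (k * n) \<Longrightarrow> measure_pmf.prob \<T> {T. run (k * n) T x \<noteq> direct_power n k f x} \<le> 1/3"
    and small: "3519 * (\<gamma> * d * log 2 n) < 19/500 * k"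
  shows "real (D_pdt (1/3) n f (Pi_pmf {..<n} False (\<lambda>i. bernoulli_pmf (p i)))) \<le> 1 / \<gamma>"
proof (rule ccontr)
  assume contra: "\<not> ?thesis"
  define K where "K = k * n"
  define m where "m i \<longleftrightarrow> i < K \<and> p (i mod n) > 1/2" for i
  define r where "r i = (if i < K then p (i mod n) else 0)" for i
  define p' where "p' i = (if i < K then min (p (i mod n)) (1 - p (i mod n)) else 0)" for i
  define F where "F j x = f (block n j (\<lambda>i. x i \<noteq> m i))" for j x
  let ?o = "\<lambda>_ :: nat. False"
  have pm: "0 \<le> p (i mod n)" "p (i mod n) \<le> 1" for i
    using p[of "i mod n"] n by auto
  have r: "biases r" and p': "biases p'" "\<And>i. p' i \<le> 1/2"
    using pm by (auto simp: biases_def r_def p'_def min_def)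
  have p'_eq: "p' = (\<lambda>i. if m i then 1 - r i else r i)"
    by (auto simp: p'_def m_def r_def)
  have v: "1/3 \<le> avg p' {j * n..<Suc j * n} (cap_loss \<gamma> (\<lambda>x y. of_bool (y \<noteq> F j x)) S) ?o"
    if "j < k" "over {j * n..<Suc j * n} S" for j S
    using block_complexity[where k = k and \<epsilon> = "1/3", OF p that(1) \<gamma> that(2)] contra
    unfolding F_def m_def[abs_def] p'_def[abs_def] K_def by (meson linear)
  define B where "B j x T \<longleftrightarrow> run K T x j \<noteq> f (block n j x)" for j x and T :: "(nat \<Rightarrow> bool) pdt"
  have "\<exists>t1\<in>set_pmf \<T>. \<exists>t2\<in>set_pmf \<T>. \<exists>t3\<in>set_pmf \<T>.
    avg r {..<K} (\<lambda>x. \<Sum>j<k. of_bool (maj (B j x t1) (B j x t2) (B j x t3))) ?o \<le> 7/27 * k"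
  proof (rule majority_of_three[OF finite_lessThan r])
    fix j x assume j: "j < k" and x: "\<And>i. i \<notin> {..<K} \<Longrightarrow> x i = False"
    have "measure_pmf.prob \<T> {T. B j x T} \<le> measure_pmf.prob \<T> {T. run K T x \<noteq> direct_power n k f x}"
      using j by (intro measure_pmf.finite_measure_mono) (auto simp: B_def direct_power_def fun_eq_iff)
    also have "\<dots> \<le> 1/3"
      unfolding K_def by (rule err) (use x in \<open>simp add: cube_def K_def\<close>)
    finally show "measure_pmf.prob \<T> {T. B j x T} \<le> 1/3" .
  qed
  then obtain t1 t2 t3 where t: "t1 \<in> set_pmf \<T>" "t2 \<in> set_pmf \<T>" "t3 \<in> set_pmf \<T>"
    "avg r {..<K} (\<lambda>x. \<Sum>j<k. of_bool (maj (B j x t1) (B j x t2) (B j x t3))) ?o \<le> 7/27 * k"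
    by (elim bexE)
  \<comment> \<open>The three trees are run in sequence, at a cost of at most \<open>3 * d\<close>,
    and every output bit is decided by its own majority.\<close>
  define T0 where "T0 = graft (qtree_of_pdt K t1) (\<lambda>y1. graft (qtree_of_pdt K t2) (\<lambda>y2.
    graft (qtree_of_pdt K t3) (\<lambda>y3. QLeaf (\<lambda>j. maj (y1 j) (y2 j) (y3 j)))))"
  have T0: "over {..<K} T0"
    unfolding T0_def by (intro over_graft over_of_pdt) simp
  have T0_run: "qrun T0 x = (\<lambda>j. maj (run K t1 x j) (run K t2 x j) (run K t3 x j))" for x
    by (simp add: T0_def)
  have T0_cost: "real (qcost T0 x) \<le> 3 * d" for x
  proof -
    have "qcost T0 x \<le> depth t1 + depth t2 + depth t3"
      using qcost_of_pdt[of K t1 x] qcost_of_pdt[of K t2 x] qcost_of_pdt[of K t3 x] by (simp add: T0_def)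
    also have "\<dots> \<le> d + d + d"
      using depth t by (intro add_mono) auto
    finally show ?thesis by simp
  qed
  define T where "T = qsubst (\<lambda>x i. x i \<noteq> m i) T0"
  have T: "over {..<k * n} T"
    unfolding T_def K_def[symmetric] by (rule over_subst[OF T0]) (intro aff_xor aff_coord aff_const)
  define e where "e = nat \<lceil>log 2 n\<rceil>"
  \<comment> \<open>51 is (1 + \<theta>) / \<theta> for \<theta> = 1/50. The choice N = e + 7 keeps
    the search errors of a block below 2 n / 2^(e+7) \<le> 1/64 in total.\<close>
  define \<Gamma> where "\<Gamma> = 51 * \<gamma> * (2 * (real (e + 7) + real e) + 1)"
  have lg: "1 \<le> log 2 n"
    using n by (subst le_log_iff) auto
  have e: "real e \<le> log 2 n + 1"
    unfolding e_def using lg by linarith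
  have "log 2 n \<le> real e"
    unfolding e_def using lg by linarith
  then have "2 powr (log 2 n) \<le> 2 powr real e"
    by simp
  then have n_le': "real n \<le> 2 ^ e"
    using n by (simp add: powr_realpow)
  then have "real n \<le> real (2 ^ e)"
    by simp
  then have n_le: "n \<le> 2 ^ e"
    by (simp only: of_nat_le_iff)
  have \<Gamma>: "0 \<le> \<Gamma>" "\<gamma> * (2 * (real (e + 7) + real e) + 1) * (1 + 1/50) \<le> \<Gamma> * (1/50)"
    using \<gamma> by (simp_all add: \<Gamma>_def)
  have "real k * (1/3) \<le> avg p' {..<k * n} (\<lambda>x. (\<Sum>j<k. of_bool (qrun T x j \<noteq> F j x)) + \<Gamma> * qcost T x) ?o +
      k * (1/50 + n * (2 * (1/2) ^ (e + 7)))"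
  proof (rule direct_sum[OF p' _ _ _ \<Gamma> n_le _ v order_refl T])
    show "F j x = F j y" if "\<And>i. i \<in> {j * n..<Suc j * n} \<Longrightarrow> x i = y i" for j x y
    proof -
      have "block n j (\<lambda>i. x i \<noteq> m i) = block n j (\<lambda>i. y i \<noteq> m i)"
        using that by (auto simp: block_def fun_eq_iff)
      then show ?thesis
        by (simp only: F_def)
    qed
  qed (use \<gamma> in auto)
  also have "avg p' {..<k * n} (\<lambda>x. (\<Sum>j<k. of_bool (qrun T x j \<noteq> F j x)) + \<Gamma> * qcost T x) ?o =
      avg r {..<K} (\<lambda>x. (\<Sum>j<k. of_bool (qrun T0 x j \<noteq> f (block n j x))) + \<Gamma> * qcost T0 x) m"
  proof -
    have "(\<lambda>i. m i \<noteq> m i) = ?o" "\<And>x. (\<lambda>i. (x i \<noteq> m i) \<noteq> m i) = x"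
      by auto
    then show ?thesis
      using avg_flip[OF finite_lessThan[of K] r, where m = m and z = m and
        \<phi> = "\<lambda>x. (\<Sum>j<k. of_bool (qrun T x j \<noteq> F j x)) + \<Gamma> * qcost T x"]
      unfolding p'_eq K_def[symmetric] by (simp only: T_def F_def qrun_subst qcost_subst)
  qed
  also have "\<dots> = avg r {..<K} (\<lambda>x. (\<Sum>j<k. of_bool (qrun T0 x j \<noteq> f (block n j x))) + \<Gamma> * qcost T0 x) ?o"
    by (rule avg_base_cong) (simp add: m_def)
  also have "\<dots> \<le> avg r {..<K} (\<lambda>x. (\<Sum>j<k. of_bool (maj (B j x t1) (B j x t2) (B j x t3))) + \<Gamma> * (3 * d)) ?o"
  proof (rule avg_mono)
    fix x
    have "(qrun T0 x j \<noteq> f (block n j x)) = maj (B j x t1) (B j x t2) (B j x t3)" for j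
      by (auto simp: T0_run B_def maj_def)
    then show "(\<Sum>j<k. of_bool (qrun T0 x j \<noteq> f (block n j x))) + \<Gamma> * qcost T0 x \<le>
        (\<Sum>j<k. of_bool (maj (B j x t1) (B j x t2) (B j x t3))) + \<Gamma> * (3 * d)"
      using mult_left_mono[OF T0_cost \<Gamma>(1)] by simp
  qed simp
  also have "\<dots> \<le> 7/27 * k + \<Gamma> * (3 * d)"
    using t(4) by (simp add: avg_add)
  finally have "real k * (1/3) \<le> 7/27 * k + \<Gamma> * (3 * d) + k * (1/50 + n * (2 * (1/2) ^ (e + 7)))"
    by simp
  moreover have "real n * (2 * (1/2) ^ (e + 7)) \<le> 1/64"
  proof -
    have "real n * (2 * (1/2) ^ (e + 7)) \<le> 2 ^ e * (2 * (1/2) ^ (e + 7))"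
      using n_le' by (rule mult_right_mono) simp
    also have "\<dots> = 1/64"
      by (simp add: power_add power_one_over)
    finally show ?thesis .
  qed
  then have "k * (1/50 + n * (2 * (1/2) ^ (e + 7))) \<le> k * (1/50 + 1/64)"
    by (intro mult_left_mono) auto
  moreover have "\<Gamma> * (3 * d) \<le> 3519 * (\<gamma> * d * log 2 n)"
  proof -
    \<comment> \<open>The left side is at most 4 log n + 19, and log n is at least 1.\<close>
    have "2 * (real (e + 7) + real e) + 1 \<le> 23 * log 2 n"
      using e lg by simp
    then have "(153 * \<gamma> * d) * (2 * (real (e + 7) + real e) + 1) \<le> (153 * \<gamma> * d) * (23 * log 2 n)"
      using \<gamma> by (intro mult_left_mono) auto
    then show ?thesis
      by (simp add: \<Gamma>_def algebra_simps)
  qed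
  \<comment> \<open>The gap 1/3 - 7/27 = 2/27 exceeds 19/500 + 1/50 + 1/64.\<close>
  ultimately have "real k * (1/3) < 7/27 * k + 19/500 * k + k * (1/50 + 1/64)"
    using small by linarith
  then show False
    by simp
qed

theorem theorem2:
  shows "\<exists>c::real. c > 0 \<and>
    (\<forall>(n::nat) (k::nat) (f :: (nat \<Rightarrow> bool) \<Rightarrow> bool). n \<ge> 2 \<longrightarrow> k \<ge> 1 \<longrightarrow>
       real (R_pdt (k * n) k (direct_power n k f)) \<ge> c * (real k / log 2 (real n)) * real (D_prod n f))"
proof (intro exI[of _ "1/100000"] conjI allI impI)
  fix n k :: nat and f :: "(nat \<Rightarrow> bool) \<Rightarrow> bool"
  assume n: "2 \<le> n" and k: "1 \<le> k"
  define d where "d = R_pdt (k * n) k (direct_power n k f)"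
  have lg: "1 \<le> log 2 n"
    using n by (subst le_log_iff) auto
  obtain \<T> where \<T>: "\<forall>T\<in>set_pmf \<T>. is_pdt (k * n) (cube k) T \<and> depth T \<le> d"
    "\<forall>x\<in>cube (k * n). measure_pmf.prob \<T> {T. run (k * n) T x \<noteq> direct_power n k f x} \<le> 1/3"
    using R_pdt_attained[of "k * n" "direct_power n k f" k] by (auto simp: cube_def direct_power_def d_def)
  obtain \<mu> where \<mu>: "product_dist n \<mu>" "D_prod n f = D_pdt (1/3) n f \<mu>"
    using D_prod_attained by blast
  obtain p :: "nat \<Rightarrow> real" where p: "\<forall>i<n. 0 \<le> p i \<and> p i \<le> 1"
    "\<mu> = Pi_pmf {..<n} False (\<lambda>i. bernoulli_pmf (p i))"
    using \<mu>(1) by (auto simp: product_dist_def)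
  have D: "real (D_prod n f) \<le> 1 / \<gamma>" if "0 < \<gamma>" "3519 * (\<gamma> * d * log 2 n) < 19/500 * k" for \<gamma> :: real
    unfolding \<mu>(2) p(2) by (rule D_pdt_direct_sum[OF n that(1) _ _ _ that(2)]) (use p \<T> in auto)
  show "1/100000 * (real k / log 2 (real n)) * real (D_prod n f) \<le> real (R_pdt (k * n) k (direct_power n k f))"
  proof (cases "d = 0")
    case True
    \<comment> \<open>Without queries every positive \<gamma> satisfies the condition, and \<gamma>
      = 2 forces the integer \<open>D_prod n f\<close> to be 0.\<close>
    then have "real (D_prod n f) \<le> 1 / 2"
      using D[of 2] k by simp
    then have "D_prod n f = 0"
      by simp
    then show ?thesis
      by simp
  next
    case False
    \<comment> \<open>This \<gamma> is admissible because 3519/100000 < 19/500.\<close>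
    have "real (D_prod n f) \<le> 1 / (k / (100000 * d * log 2 n))"
      using False k lg by (intro D) (auto simp: field_simps)
    then have "1/100000 * (real k / log 2 (real n)) * real (D_prod n f) \<le>
        1/100000 * (real k / log 2 (real n)) * (1 / (k / (100000 * d * log 2 n)))"
      using lg by (intro mult_left_mono) auto
    also have "\<dots> = d"
      using lg k by (simp add: field_simps)
    finally show ?thesis
      by (simp add: d_def)
  qed
qed simp

end
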